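(* Let $\nu(x)=\sum_{p\ge2}\gamma_p^2x^p$ be a mixture. Then for any $q\in[0,1]$, $$E_\star(q)\ \ge\ \int_0^q\nu''(t)^{1/2}\,dt ,$$ where $-E_\star(q)$ is the limiting normalized ground-state energy, on the sphere of radius $\sqrt{Nq}$, of the spherical spin glass Hamiltonian with mixture $\nu$.
   Context: Mixture and Hamiltonian: $\gamma_p\ge0$, $p\ge2$, is a deterministic sequence decaying exponentially in $p$, and $\nu(x)=\sum_{p\ge2}\gamma_p^2x^p$. With $J^{(p)}_{i_1,\dots,i_p}$ i.i.d. standard Gaussian variables, for $\boldsymbol\sigma\in\mathbb R^N$ with $\|\boldsymbol\sigma\|\le\sqrt N$, $$H_N(\boldsymbol\sigma)=\sum_{p=2}^\infty\frac{\gamma_p}{N^{(p-1)/2}}\sum_{i_1,\dots,i_p=1}^NJ^{(p)}_{i_1,\dots,i_p}\sigma_{i_1}\cdots\sigma_{i_p}.$$ Ground-state energy: $-E_\star(q):=\lim_{N\to\infty}\frac1N\mathbb E\min_{\|\boldsymbol\sigma\|=\sqrt{Nq}}H_N(\boldsymbol\sigma)$ for $q\in[0,1]$ (the limit is known to exist, and also to equal the almost sure limit of $\frac1N\min_{\|\boldsymbol\sigma\|=\sqrt{Nq}}H_N(\boldsymbol\sigma)$). *)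

theory Defs
  imports "HOL-Probability.Probability"
begin

(* Only the values at p >= 2 matter. *)
definition is_mixture :: "(nat \<Rightarrow> real) \<Rightarrow> bool" where
  "is_mixture \<gamma> \<longleftrightarrow>
     (\<forall>p\<ge>2. 0 \<le> \<gamma> p) \<and>
     (\<exists>C r. 0 < r \<and> r < 1 \<and> (\<forall>p\<ge>2. \<gamma> p \<le> C * r ^ p))"

definition mixture :: "(nat \<Rightarrow> real) \<Rightarrow> real \<Rightarrow> real" where
  "mixture \<gamma> x = (\<Sum>k. (\<gamma> (k + 2))\<^sup>2 * x ^ (k + 2))"

(* A tuple (i_1, ..., i_p) is a list, so p is its length and J needs no separate
   index p. One infinite family serves all dimensions N. *)
definition gaussian_disorder :: "'w measure \<Rightarrow> (nat list \<Rightarrow> 'w \<Rightarrow> real) \<Rightarrow> bool" where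
  "gaussian_disorder M J \<longleftrightarrow>
     prob_space M \<and>
     prob_space.indep_vars M (\<lambda>_. borel) J {is. 2 \<le> length is \<and> set is \<subseteq> {1..}} \<and>
     (\<forall>is. 2 \<le> length is \<and> set is \<subseteq> {1..} \<longrightarrow>
        distributed M lborel (J is) std_normal_density)"

definition p_spin :: "(nat list \<Rightarrow> real) \<Rightarrow> nat \<Rightarrow> nat \<Rightarrow> (nat \<Rightarrow> real) \<Rightarrow> real" where
  "p_spin g p N \<sigma> = (\<Sum>is | length is = p \<and> set is \<subseteq> {1..N}. g is * (\<Prod>i\<leftarrow>is. \<sigma> i))"

(* The argument g is one realization of the disorder. *)
definition hamiltonian ::
    "(nat \<Rightarrow> real) \<Rightarrow> (nat list \<Rightarrow> real) \<Rightarrow> nat \<Rightarrow> (nat \<Rightarrow> real) \<Rightarrow> real" where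
  "hamiltonian \<gamma> g N \<sigma> =
     (\<Sum>k. let p = k + 2 in \<gamma> p / real N powr ((real p - 1) / 2) * p_spin g p N \<sigma>)"

(* A vector of R^N is an extensional function on {1..N}. *)
definition sphere_N :: "nat \<Rightarrow> real \<Rightarrow> (nat \<Rightarrow> real) set" where
  "sphere_N N r = {\<sigma> \<in> {1..N} \<rightarrow>\<^sub>E UNIV. L2_set \<sigma> {1..N} = r}"

(* Almost surely the series converges uniformly on the sphere, so the Hamiltonian is
   continuous there and the infimum is a minimum. On the exceptional null set the infimum
   is an arbitrary value and need not be measurable with respect to M, hence the
   completion; for M-measurable integrands both integrals agree. *)
definition mean_min_energy ::
    "'w measure \<Rightarrow> (nat list \<Rightarrow> 'w \<Rightarrow> real) \<Rightarrow> (nat \<Rightarrow> real) \<Rightarrow> real \<Rightarrow> nat \<Rightarrow> real" where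
  "mean_min_energy M J \<gamma> q N =
     1 / real N *
     (\<integral>\<omega>. (INF \<sigma>\<in>sphere_N N (sqrt (real N * q)). hamiltonian \<gamma> (\<lambda>is. J is \<omega>) N \<sigma>)
        \<partial>completion M)"

definition E_star ::
    "'w measure \<Rightarrow> (nat list \<Rightarrow> 'w \<Rightarrow> real) \<Rightarrow> (nat \<Rightarrow> real) \<Rightarrow> real \<Rightarrow> real" where
  "E_star M J \<gamma> q = - lim (mean_min_energy M J \<gamma> q)"

end

(*
  For the Gaussian process y |-> H(y) on the sphere |y|^2 = r of R^A with covariance k(<y,z>),
  k a polynomial with nonnegative coefficients, the degree-one part of H is sqrt(k'(0)) <g,y>
  with g a standard Gaussian vector independent of the rest.  Restrict the supremum to
  y = sqrt d g/|g| + y' with y' orthogonal to g.  The degree-one part then contributes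
  sqrt(d k'(0)) |g|, which is about sqrt(d k'(0) card A), and by rotation invariance the rest is a
  process of the same kind in y', in one dimension less, on the sphere of squared radius r - d,
  with covariance x |-> k(d + x) - k'(0) (d + x).  Iterating from k = N nu with d = q/m, the slopes
  k'(0) are N (nu'(j d) - nu'((j-1) d)) >= N d nu''((j-1) d), so in total one gains N
  times a Riemann sum of sqrt(nu''), up to a factor tending to 1 as N tends to infinity.

  Only expectations of suprema are needed, and these depend on the covariance alone; this replaces
  any measurable selection of the directions.  Infinite mixtures are truncated at a degree which
  tends to infinity for fixed N, before N does.
*)
theory Submission
  imports Defs "HOL-Computational_Algebra.Polynomial" "HOL-Real_Asymp.Real_Asymp"
begin

section \<open>Reflections and the standard Gaussian measure\<close>

text \<open>Once \<open>g\<close> is frozen, rotating it onto a coordinate axis changes the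
  remaining terms but not their covariance. Their expected supremum is therefore the same number for
  every \<open>g\<close>, and Fubini completes the step. That expected suprema see only the
  covariance is proved by rotating one representing family of vectors onto another. Rotations enter
  solely as compositions of reflections: a reflection is its own adjoint and has an explicit
  formula, so invariance of the Gaussian measure has to be checked for this one kind of map.

  The random length of \<open>g\<close> costs a correction, \<open>sqrt n - 1 / sqrt n\<close> in
  place of \<open>sqrt n\<close>, and each step costs a dimension. Both losses vanish in the limit
  because the number of steps stays fixed while the dimension grows; the steps are refined last.

  The first slope is \<nu>'(0) = 0, so one more step is run than there are terms in the Riemann sum.
  Minima become suprema by passing to the negated Hamiltonian, which has the same
  covariance.\<close>

definition ip :: "'i set \<Rightarrow> ('i \<Rightarrow> real) \<Rightarrow> ('i \<Rightarrow> real) \<Rightarrow> real" where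
  "ip I x y = (\<Sum>i\<in>I. x i * y i)"

text \<open>For \<open>w = 0\<close> this is the identity, since \<open>x / 0 = 0\<close>.\<close>

definition refl_along :: "'i set \<Rightarrow> ('i \<Rightarrow> real) \<Rightarrow> ('i \<Rightarrow> real) \<Rightarrow> 'i \<Rightarrow> real" where
  "refl_along I w x = (\<lambda>i\<in>I. x i - 2 * ip I w x / ip I w w * w i)"

abbreviation std_gaussian :: "'i set \<Rightarrow> ('i \<Rightarrow> real) measure" where
  "std_gaussian I \<equiv> PiM I (\<lambda>_. std_normal_distribution)"

lemma ip_commute: "ip I x y = ip I y x"
  by (simp add: ip_def mult.commute)

lemma ip_cong: "(\<And>i. i \<in> I \<Longrightarrow> x i = x' i) \<Longrightarrow> (\<And>i. i \<in> I \<Longrightarrow> y i = y' i) \<Longrightarrow> ip I x y = ip I x' y'"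
  by (simp add: ip_def)

lemma ip_nonneg [simp]: "0 \<le> ip I x x"
  by (simp add: ip_def sum_nonneg)

lemma ip_self_eq_0: "finite I \<Longrightarrow> ip I x x = 0 \<longleftrightarrow> (\<forall>i\<in>I. x i = 0)"
  by (simp add: ip_def sum_nonneg_eq_0_iff)

lemma ip_diff_left: "ip I (\<lambda>i. x i - y i) z = ip I x z - ip I y z"
  by (simp add: ip_def left_diff_distrib sum_subtractf)

lemma ip_scale_left: "ip I (\<lambda>i. c * x i) z = c * ip I x z"
  by (simp add: ip_def sum_distrib_left mult.assoc)

lemma ip_refl_along:
  assumes "finite I"
  shows "ip I (refl_along I w x) y = ip I x y - 2 * ip I w x * ip I w y / ip I w w"
proof -
  have "ip I (refl_along I w x) y = ip I (\<lambda>i. x i - 2 * ip I w x / ip I w w * w i) y"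
    by (rule ip_cong) (auto simp: refl_along_def)
  also have "\<dots> = ip I x y - 2 * ip I w x / ip I w w * ip I w y"
    unfolding ip_diff_left using ip_scale_left[of I "2 * ip I w x / ip I w w" w y] by simp
  finally show ?thesis by simp
qed

lemma ip_refl_along_adjoint:
  "finite I \<Longrightarrow> ip I (refl_along I w x) y = ip I x (refl_along I w y)"
  using ip_refl_along[of I w x y] ip_refl_along[of I w y x] ip_commute[of I x y]
    ip_commute[of I x "refl_along I w y"] by simp

lemma ip_refl_along_isometry:
  assumes "finite I"
  shows "ip I (refl_along I w x) (refl_along I w y) = ip I x y"
proof (cases "ip I w w = 0")
  case True
  then show ?thesis using assms
    by (simp add: ip_refl_along ip_refl_along_adjoint[symmetric])
next
  case False
  have "ip I w (refl_along I w y) = - ip I w y"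
    using False assms ip_refl_along[of I w y w] ip_commute[of I w y] ip_commute[of I w "refl_along I w y"]
    by simp
  moreover have "ip I x (refl_along I w y) = ip I x y - 2 * ip I w x * ip I w y / ip I w w"
    using assms by (simp add: ip_refl_along_adjoint[symmetric] ip_refl_along)
  ultimately show ?thesis using assms by (simp add: ip_refl_along)
qed

text \<open>With \<open>w = a - b\<close>, equal norms give \<open>ip I w w = 2 * ip I w a\<close>,
  so the reflection subtracts exactly \<open>w\<close> from \<open>a\<close>. If \<open>w\<close>
  vanishes on \<open>I\<close>, the vectors already agree there.\<close>

lemma refl_along_diff_eq:
  assumes "finite I" "ip I a a = ip I b b" "i \<in> I"
  shows "refl_along I (\<lambda>i. a i - b i) a i = b i"
proof -
  define w where "w = (\<lambda>i. a i - b i)"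
  have ww: "ip I w w = 2 * ip I w a"
    using assms(2) unfolding w_def ip_diff_left
    by (subst (1 2) ip_commute, unfold ip_diff_left) (simp add: ip_commute)
  show ?thesis
  proof (cases "ip I w w = 0")
    case True
    then show ?thesis using assms by (auto simp: ip_self_eq_0 w_def[symmetric] refl_along_def) (auto simp: w_def)
  next
    case False
    then show ?thesis using assms(3) ww unfolding w_def[symmetric]
      by (simp add: refl_along_def) (simp add: w_def)
  qed
qed

section \<open>Reflection invariance of product Lebesgue and Gaussian measure\<close>

interpretation lborel_product: product_sigma_finite "\<lambda>_::'i. lborel :: real measure"
  by standard

interpretation normal_product: product_sigma_finite "\<lambda>_::'i. std_normal_distribution"
  by (simp add: product_sigma_finite_def prob_space_imp_sigma_finite prob_space_normal_density)

text \<open>Separates rotation invariance into two facts: invariance of product Lebesgue measure,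
  and dependence of the density on the norm alone. The induction peels off one coordinate by
  iterated integration.\<close>

lemma nn_integral_std_gaussian_density:
  assumes "finite I" "f \<in> borel_measurable (PiM I (\<lambda>_. lborel))"
  shows "(\<integral>\<^sup>+x. f x \<partial>std_gaussian I) =
    (\<integral>\<^sup>+x. (\<Prod>i\<in>I. ennreal (std_normal_density (x i))) * f x \<partial>PiM I (\<lambda>_. lborel))"
  using assms
proof (induction I arbitrary: f)
  case empty
  then show ?case by (simp add: PiM_empty)
next
  case (insert j I)
  have S: "sets (std_gaussian K) = sets (PiM K (\<lambda>_. lborel))" for K :: "'a set"
    by (rule sets_PiM_cong) auto
  have [measurable]: "f \<in> borel_measurable (PiM (insert j I) (\<lambda>_. lborel))"
    by (rule insert.prems)
  have [measurable]: "f \<in> borel_measurable (std_gaussian (insert j I))"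
    using insert.prems by (simp cong: measurable_cong_sets add: S)
  have upd: "(\<lambda>(x, y). f (x(j := y))) \<in> borel_measurable (PiM I (\<lambda>_. lborel) \<Otimes>\<^sub>M lborel)"
    by measurable
  have [measurable]: "(\<lambda>x. \<integral>\<^sup>+y. ennreal (std_normal_density y) * f (x(j := y)) \<partial>lborel)
      \<in> borel_measurable (PiM I (\<lambda>_. lborel))"
    by (rule lborel.borel_measurable_nn_integral) (use upd in measurable)
  have "(\<integral>\<^sup>+x. f x \<partial>std_gaussian (insert j I)) =
      (\<integral>\<^sup>+x. \<integral>\<^sup>+y. f (x(j := y)) \<partial>std_normal_distribution \<partial>std_gaussian I)"
    by (rule normal_product.product_nn_integral_insert) (use insert.hyps in measurable)
  also have "\<dots> = (\<integral>\<^sup>+x. \<integral>\<^sup>+y. ennreal (std_normal_density y) * f (x(j := y)) \<partial>lborel \<partial>std_gaussian I)"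
  proof (rule nn_integral_cong)
    fix x assume "x \<in> space (std_gaussian I)"
    then have "x \<in> space (PiM I (\<lambda>_. lborel :: real measure))" by (simp add: space_PiM)
    from measurable_Pair2[OF upd this] show "(\<integral>\<^sup>+y. f (x(j := y)) \<partial>std_normal_distribution) =
      (\<integral>\<^sup>+y. ennreal (std_normal_density y) * f (x(j := y)) \<partial>lborel)"
      by (intro nn_integral_density) auto
  qed
  also have "\<dots> = (\<integral>\<^sup>+x. (\<Prod>i\<in>I. ennreal (std_normal_density (x i))) *
      (\<integral>\<^sup>+y. ennreal (std_normal_density y) * f (x(j := y)) \<partial>lborel) \<partial>PiM I (\<lambda>_. lborel))"
    by (rule insert.IH) measurable
  also have "\<dots> = (\<integral>\<^sup>+x. \<integral>\<^sup>+y. (\<Prod>i\<in>insert j I. ennreal (std_normal_density ((x(j := y)) i))) * f (x(j := y))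
      \<partial>lborel \<partial>PiM I (\<lambda>_. lborel))"
  proof (rule nn_integral_cong)
    fix x assume x: "x \<in> space (PiM I (\<lambda>_. lborel :: real measure))"
    have *: "(\<Prod>i\<in>I. ennreal (std_normal_density ((x(j := y)) i))) = (\<Prod>i\<in>I. ennreal (std_normal_density (x i)))" for y
      using insert.hyps by (intro prod.cong) auto
    have "(\<lambda>y. ennreal (std_normal_density y) * f (x(j := y))) \<in> borel_measurable lborel"
      using measurable_Pair2[OF upd x] by simp
    then show "(\<Prod>i\<in>I. ennreal (std_normal_density (x i))) *
        (\<integral>\<^sup>+y. ennreal (std_normal_density y) * f (x(j := y)) \<partial>lborel) =
      (\<integral>\<^sup>+y. (\<Prod>i\<in>insert j I. ennreal (std_normal_density ((x(j := y)) i))) * f (x(j := y)) \<partial>lborel)"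
      using insert.hyps
      by (simp add: * nn_integral_cmult[symmetric] mult_ac fun_upd_same del: fun_upd_apply)
  qed
  also have "\<dots> = (\<integral>\<^sup>+x. (\<Prod>i\<in>insert j I. ennreal (std_normal_density (x i))) * f x \<partial>PiM (insert j I) (\<lambda>_. lborel))"
    by (rule lborel_product.product_nn_integral_insert[symmetric]) (use insert.hyps in measurable)
  finally show ?case .
qed

text \<open>A product measure is determined by its values on boxes, and a translation acts on each
  side of a box separately.\<close>

lemma nn_integral_PiM_lborel_translate:
  assumes "finite K" and [measurable]: "f \<in> borel_measurable (PiM K (\<lambda>_. lborel))"
  shows "(\<integral>\<^sup>+x. f (\<lambda>i\<in>K. x i + v i) \<partial>PiM K (\<lambda>_. lborel)) = (\<integral>\<^sup>+x. f x \<partial>PiM K (\<lambda>_. lborel :: real measure))"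
proof -
  let ?P = "PiM K (\<lambda>_. lborel :: real measure)"
  have T[measurable]: "(\<lambda>x. \<lambda>i\<in>K. x i + v i) \<in> ?P \<rightarrow>\<^sub>M ?P" by measurable
  have "distr ?P ?P (\<lambda>x. \<lambda>i\<in>K. x i + v i) = ?P"
  proof (rule lborel_product.PiM_eqI)
    fix A :: "'a \<Rightarrow> real set" assume A: "\<And>i. i \<in> K \<Longrightarrow> A i \<in> sets lborel"
    have pre: "(\<lambda>x. \<lambda>i\<in>K. x i + v i) -` Pi\<^sub>E K A \<inter> space ?P = Pi\<^sub>E K (\<lambda>i. (\<lambda>y. y + v i) -` A i)"
      by (auto simp: space_PiM PiE_def Pi_def)
    have m: "(\<lambda>y. y + v i) -` A i \<in> sets lborel" if "i \<in> K" for i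
      using measurable_sets[of "\<lambda>y. y + v i" lborel lborel "A i"] A[OF that] by simp
    have "emeasure (distr ?P ?P (\<lambda>x. \<lambda>i\<in>K. x i + v i)) (Pi\<^sub>E K A) =
        emeasure ?P (Pi\<^sub>E K (\<lambda>i. (\<lambda>y. y + v i) -` A i))"
      using A assms(1) by (subst emeasure_distr) (auto simp: pre intro!: sets_PiM_I_finite)
    also have "\<dots> = (\<Prod>i\<in>K. emeasure lborel ((\<lambda>y. y + v i) -` A i))"
      using m assms(1) by (intro lborel_product.emeasure_PiM) auto
    also have "\<dots> = (\<Prod>i\<in>K. emeasure lborel (A i))"
    proof (rule prod.cong[OF refl])
      fix i assume "i \<in> K"
      have "emeasure lborel (A i) = emeasure (distr lborel borel ((+) (v i))) (A i)"
        by (simp add: lborel_distr_plus)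
      also have "\<dots> = emeasure lborel ((+) (v i) -` A i)"
        using A[OF \<open>i \<in> K\<close>] by (subst emeasure_distr) auto
      also have "(+) (v i) = (\<lambda>y. y + v i)" by (simp add: fun_eq_iff)
      finally show "emeasure lborel ((\<lambda>y. y + v i) -` A i) = emeasure lborel (A i)" by (rule sym)
    qed
    finally show "emeasure (distr ?P ?P (\<lambda>x. \<lambda>i\<in>K. x i + v i)) (Pi\<^sub>E K A) = (\<Prod>i\<in>K. emeasure lborel (A i))" .
  qed (use assms in auto)
  then have "(\<integral>\<^sup>+x. f x \<partial>?P) = (\<integral>\<^sup>+x. f x \<partial>distr ?P ?P (\<lambda>x. \<lambda>i\<in>K. x i + v i))"
    by (rule arg_cong[OF sym])
  also have "\<dots> = (\<integral>\<^sup>+x. f (\<lambda>i\<in>K. x i + v i) \<partial>?P)"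
    by (rule nn_integral_distr) measurable
  finally show ?thesis by (rule sym)
qed

text \<open>In a coordinate \<open>j\<close> with \<open>w j \<noteq> 0\<close>, substitute \<open>s = ip I w x\<close> for \<open>x j\<close>. The reflection
  maps \<open>s\<close> to \<open>- s\<close> and, for fixed \<open>s\<close>, translates the other coordinates.\<close>

lemma nn_integral_PiM_lborel_refl_along:
  assumes "finite I" and f: "f \<in> borel_measurable (PiM I (\<lambda>_. lborel))"
  shows "(\<integral>\<^sup>+x. f (refl_along I w x) \<partial>PiM I (\<lambda>_. lborel)) = (\<integral>\<^sup>+x. f x \<partial>PiM I (\<lambda>_. lborel :: real measure))"
proof (cases "ip I w w = 0")
  case True
  have "f (refl_along I w x) = f x" if "x \<in> space (PiM I (\<lambda>_. lborel :: real measure))" for x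
  proof -
    have "refl_along I w x = restrict x I"
      using True by (auto simp: refl_along_def)
    then show ?thesis using that by (simp add: space_PiM)
  qed
  then show ?thesis by (intro nn_integral_cong)
next
  case False
  then obtain j where j: "j \<in> I" "w j \<noteq> 0" using assms(1) by (auto simp: ip_self_eq_0)
  define K where "K = I - {j}"
  have I: "I = insert j K" "finite K" "j \<notin> K" using j assms(1) by (auto simp: K_def)
  define \<alpha> where "\<alpha> = 2 / ip I w w"
  let ?K = "PiM K (\<lambda>_. lborel :: real measure)"
  \<comment> \<open>The coordinate \<open>j\<close> is chosen so that \<open>ip I w\<close> of the
    updated point equals \<open>- s\<close>.\<close>
  let ?h = "\<lambda>x s. f (x(j := (- s - ip K w x) / w j))"
  have [measurable]: "f \<in> borel_measurable (PiM (insert j K) (\<lambda>_. lborel))" using f I by simp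
  have upd: "(\<lambda>(x, y). f (x(j := y))) \<in> borel_measurable (?K \<Otimes>\<^sub>M lborel)"
    by measurable
  have ipm[measurable]: "(\<lambda>x. ip K w x) \<in> borel_measurable ?K"
    unfolding ip_def by measurable
  have rm[measurable]: "refl_along I w \<in> PiM I (\<lambda>_. lborel) \<rightarrow>\<^sub>M PiM I (\<lambda>_. lborel)"
    unfolding refl_along_def[abs_def] ip_def by measurable
  have fr: "(\<lambda>x. f (refl_along I w x)) \<in> borel_measurable (PiM (insert j K) (\<lambda>_. lborel))"
    using measurable_compose[OF rm f] I by simp
  have hm: "(\<lambda>(x, s). ?h x s) \<in> borel_measurable (?K \<Otimes>\<^sub>M lborel)"
  proof -
    have "(\<lambda>z. (fst z, (- snd z - ip K w (fst z)) / w j)) \<in> ?K \<Otimes>\<^sub>M lborel \<rightarrow>\<^sub>M ?K \<Otimes>\<^sub>M lborel"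
      by measurable
    from measurable_compose[OF this upd] show ?thesis by (simp add: split_beta)
  qed
  have sf: "sigma_finite_measure ?K" by (rule lborel_product.sigma_finite) fact
  interpret P: pair_sigma_finite ?K "lborel :: real measure"
    by (intro pair_sigma_finite.intro sf lborel.sigma_finite_measure_axioms)
  \<comment> \<open>The substitution in coordinate \<open>j\<close>, with Jacobian
    \<open>1 / \<bar>w j\<bar>\<close>. It is used with \<open>c = 1\<close> for the original point,
    where \<open>ip I w\<close> is \<open>s\<close>, and with \<open>c = -1\<close> for the
    reflected one.\<close>
  have affine: "(\<integral>\<^sup>+y. g y \<partial>lborel) = ennreal (1 / \<bar>w j\<bar>) * (\<integral>\<^sup>+s. g ((c * s - b) / w j) \<partial>lborel)"
    if [measurable]: "g \<in> borel_measurable borel" and c: "\<bar>c\<bar> = 1" for g b c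
    using nn_integral_real_affine[of g "c / w j" "- b / w j"] j c
    by (auto simp: diff_divide_distrib add.commute abs_divide intro!: arg_cong[where f="\<lambda>x. _ * nn_integral _ x"])
  have upd1: "(\<lambda>y. f (x(j := y))) \<in> borel_measurable borel" if "x \<in> space ?K" for x
    using measurable_Pair2[OF upd that] by simp
  have alg: "(s - B) / W - a * s * W = (- s - (B - a * s * Q)) / W"
    if "a * (W * W + Q) = 2" "W \<noteq> 0" for s B W a Q :: real
  proof -
    have "s * (a * (W * W + Q)) = s * 2" using that by simp
    then show ?thesis using that(2) by (simp add: field_simps)
  qed
  have key: "refl_along I w (x(j := (s - ip K w x) / w j)) =
      (\<lambda>i\<in>K. x i + (- \<alpha> * s * w i))(j := (- s - ip K w (\<lambda>i\<in>K. x i + (- \<alpha> * s * w i))) / w j)"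
    if "x \<in> space ?K" for x s
  proof -
    let ?y = "x(j := (s - ip K w x) / w j)"
    have "ip K w ?y = ip K w x" by (rule ip_cong) (use I in auto)
    then have ipy: "ip I w ?y = s" using I j by (simp add: ip_def)
    have "ip K w (\<lambda>i\<in>K. x i + (- \<alpha> * s * w i)) = ip K w x - \<alpha> * s * ip K w w"
      by (simp add: ip_def sum_distrib_left algebra_simps sum_subtractf)
    moreover have "\<alpha> * (w j * w j + ip K w w) = 2"
    proof -
      have "w j * w j + ip K w w = ip I w w" using I by (simp add: ip_def)
      then show ?thesis using False by (simp add: \<alpha>_def)
    qed
    ultimately have "(s - ip K w x) / w j - \<alpha> * s * w j =
        (- s - ip K w (\<lambda>i\<in>K. x i + (- \<alpha> * s * w i))) / w j"
      using alg j by simp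
    then show ?thesis
      using ipy I that by (auto simp: refl_along_def \<alpha>_def fun_eq_iff space_PiM)
  qed
  have "(\<integral>\<^sup>+x. f (refl_along I w x) \<partial>PiM I (\<lambda>_. lborel)) = (\<integral>\<^sup>+x. \<integral>\<^sup>+y. f (refl_along I w (x(j := y))) \<partial>lborel \<partial>?K)"
    using lborel_product.product_nn_integral_insert[OF I(2,3) fr] I by simp
  also have "\<dots> = (\<integral>\<^sup>+x. ennreal (1 / \<bar>w j\<bar>) * (\<integral>\<^sup>+s. ?h (\<lambda>i\<in>K. x i + (- \<alpha> * s * w i)) s \<partial>lborel) \<partial>?K)"
  proof (rule nn_integral_cong)
    fix x assume x: "x \<in> space ?K"
    have "(\<lambda>(x, y). f (refl_along I w (x(j := y)))) \<in> borel_measurable (?K \<Otimes>\<^sub>M lborel)"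
      using fr by measurable
    from measurable_Pair2[OF this x] have "(\<lambda>y. f (refl_along I w (x(j := y)))) \<in> borel_measurable borel" by simp
    from affine[OF this, of 1 "ip K w x"]
    show "(\<integral>\<^sup>+y. f (refl_along I w (x(j := y))) \<partial>lborel) =
      ennreal (1 / \<bar>w j\<bar>) * (\<integral>\<^sup>+s. ?h (\<lambda>i\<in>K. x i + (- \<alpha> * s * w i)) s \<partial>lborel)"
      by (simp only: key[OF x] mult_1 abs_one)
  qed
  also have "\<dots> = ennreal (1 / \<bar>w j\<bar>) * (\<integral>\<^sup>+x. \<integral>\<^sup>+s. ?h (\<lambda>i\<in>K. x i + (- \<alpha> * s * w i)) s \<partial>lborel \<partial>?K)"
  proof (rule nn_integral_cmult)
    have "(\<lambda>z. (\<lambda>i\<in>K. fst z i + (- \<alpha> * snd z * w i), snd z)) \<in> ?K \<Otimes>\<^sub>M lborel \<rightarrow>\<^sub>M ?K \<Otimes>\<^sub>M lborel"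
      by measurable
    from measurable_compose[OF this hm]
    show "(\<lambda>x. \<integral>\<^sup>+s. ?h (\<lambda>i\<in>K. x i + (- \<alpha> * s * w i)) s \<partial>lborel) \<in> borel_measurable ?K"
      by (intro lborel.borel_measurable_nn_integral) (simp add: split_beta)
  qed
  \<comment> \<open>The shift of the coordinates in \<open>K\<close> depends on \<open>s\<close>, so
    translation invariance can remove it only when the integral over \<open>s\<close> is the outer
    one.\<close>
  also have "(\<integral>\<^sup>+x. \<integral>\<^sup>+s. ?h (\<lambda>i\<in>K. x i + (- \<alpha> * s * w i)) s \<partial>lborel \<partial>?K) =
      (\<integral>\<^sup>+s. \<integral>\<^sup>+x. ?h (\<lambda>i\<in>K. x i + (- \<alpha> * s * w i)) s \<partial>?K \<partial>lborel)"
  proof (rule P.Fubini'[symmetric])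
    have "(\<lambda>z. (\<lambda>i\<in>K. fst z i + (- \<alpha> * snd z * w i), snd z)) \<in> ?K \<Otimes>\<^sub>M lborel \<rightarrow>\<^sub>M ?K \<Otimes>\<^sub>M lborel"
      by measurable
    from measurable_compose[OF this hm]
    show "(\<lambda>(x, s). ?h (\<lambda>i\<in>K. x i + (- \<alpha> * s * w i)) s) \<in> borel_measurable (?K \<Otimes>\<^sub>M lborel)"
      by (simp add: split_beta)
  qed
  also have "\<dots> = (\<integral>\<^sup>+s. \<integral>\<^sup>+x. ?h x s \<partial>?K \<partial>lborel)"
  proof (rule nn_integral_cong)
    fix s :: real
    have "(\<lambda>x. ?h x s) \<in> borel_measurable ?K"
      using measurable_Pair1[OF hm, of s] by simp
    from nn_integral_PiM_lborel_translate[OF I(2) this, of "\<lambda>i. - \<alpha> * s * w i"]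
    show "(\<integral>\<^sup>+x. ?h (\<lambda>i\<in>K. x i + (- \<alpha> * s * w i)) s \<partial>?K) = (\<integral>\<^sup>+x. ?h x s \<partial>?K)" .
  qed
  also have "\<dots> = (\<integral>\<^sup>+x. \<integral>\<^sup>+s. ?h x s \<partial>lborel \<partial>?K)"
    by (rule P.Fubini'[OF hm])
  also have "ennreal (1 / \<bar>w j\<bar>) * \<dots> = (\<integral>\<^sup>+x. ennreal (1 / \<bar>w j\<bar>) * (\<integral>\<^sup>+s. ?h x s \<partial>lborel) \<partial>?K)"
    by (rule nn_integral_cmult[symmetric]) (rule lborel.borel_measurable_nn_integral[OF hm])
  also have "\<dots> = (\<integral>\<^sup>+x. \<integral>\<^sup>+y. f (x(j := y)) \<partial>lborel \<partial>?K)"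
    using affine[OF upd1, where c="-1"] by (intro nn_integral_cong) simp
  also have "\<dots> = (\<integral>\<^sup>+x. f x \<partial>PiM I (\<lambda>_. lborel))"
    using lborel_product.product_nn_integral_insert[OF I(2,3), of f] f I by simp
  finally show ?thesis .
qed

lemma sets_std_gaussian_lborel: "sets (std_gaussian I) = sets (PiM I (\<lambda>_. lborel))"
  by (rule sets_PiM_cong) auto

lemma refl_along_measurable [measurable]: "refl_along I w \<in> std_gaussian I \<rightarrow>\<^sub>M std_gaussian I"
  unfolding refl_along_def[abs_def] ip_def by measurable

text \<open>The Gaussian density depends on \<open>x\<close> only through \<open>ip I x x\<close>,
  which a reflection preserves, and the reflection also preserves the underlying Lebesgue
  measure.\<close>

lemma distr_std_gaussian_refl_along:
  assumes "finite I"
  shows "distr (std_gaussian I) (std_gaussian I) (refl_along I w) = std_gaussian I"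
proof (rule measure_eqI)
  let ?\<phi> = "\<lambda>x. \<Prod>i\<in>I. ennreal (std_normal_density (x i))"
  have \<phi>: "?\<phi> x = ennreal ((1 / sqrt (2 * pi)) ^ card I * exp (- ip I x x / 2))" for x
  proof -
    have "?\<phi> x = ennreal (\<Prod>i\<in>I. std_normal_density (x i))"
      by (rule prod_ennreal) simp
    also have "(\<Prod>i\<in>I. std_normal_density (x i)) = (1 / sqrt (2 * pi)) ^ card I * exp (\<Sum>i\<in>I. - (x i)\<^sup>2 / 2)"
      unfolding std_normal_density_def prod.distrib exp_sum[OF assms] by simp
    also have "(\<Sum>i\<in>I. - (x i)\<^sup>2 / 2) = - ip I x x / 2"
      by (simp add: ip_def power2_eq_square sum_negf sum_divide_distrib)
    finally show ?thesis .
  qed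
  fix A assume "A \<in> sets (distr (std_gaussian I) (std_gaussian I) (refl_along I w))"
  then have A: "A \<in> sets (std_gaussian I)" by simp
  have ind: "indicator A \<in> borel_measurable (PiM I (\<lambda>_. lborel))"
    using A sets_std_gaussian_lborel by (intro borel_measurable_indicator) blast
  have rm: "refl_along I w \<in> PiM I (\<lambda>_. lborel) \<rightarrow>\<^sub>M PiM I (\<lambda>_. lborel)"
    using refl_along_measurable[of I w] by (simp cong: measurable_cong_sets add: sets_std_gaussian_lborel)
  have \<phi>m: "?\<phi> \<in> borel_measurable (PiM I (\<lambda>_. lborel))" by measurable
  have "emeasure (distr (std_gaussian I) (std_gaussian I) (refl_along I w)) A =
      (\<integral>\<^sup>+x. indicator A (refl_along I w x) \<partial>std_gaussian I)"
    using A refl_along_measurable[of I w]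
    by (simp add: nn_integral_distr nn_integral_indicator[symmetric] del: nn_integral_indicator)
  also have "\<dots> = (\<integral>\<^sup>+x. ?\<phi> x * indicator A (refl_along I w x) \<partial>PiM I (\<lambda>_. lborel))"
    by (rule nn_integral_std_gaussian_density[OF assms measurable_compose[OF rm ind]])
  also have "\<dots> = (\<integral>\<^sup>+x. ?\<phi> (refl_along I w x) * indicator A (refl_along I w x) \<partial>PiM I (\<lambda>_. lborel))"
    by (simp only: \<phi> ip_refl_along_isometry[OF assms])
  also have "\<dots> = (\<integral>\<^sup>+x. ?\<phi> x * indicator A x \<partial>PiM I (\<lambda>_. lborel))"
    by (rule nn_integral_PiM_lborel_refl_along[OF assms]) (use ind \<phi>m in measurable)
  also have "\<dots> = (\<integral>\<^sup>+x. indicator A x \<partial>std_gaussian I)"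
    by (rule nn_integral_std_gaussian_density[OF assms ind, symmetric])
  finally show "emeasure (distr (std_gaussian I) (std_gaussian I) (refl_along I w)) A = emeasure (std_gaussian I) A"
    using A by simp
qed simp

section \<open>Expected suprema of Gaussian processes\<close>

text \<open>For a standard Gaussian vector \<open>g\<close>, the process \<open>ip I (t s) g\<close>
  is centered and its covariance is the Gram matrix of \<open>t\<close>. All Gaussian processes
  below are represented in this form.\<close>

definition gsup :: "'i set \<Rightarrow> 's set \<Rightarrow> ('s \<Rightarrow> 'i \<Rightarrow> real) \<Rightarrow> ('i \<Rightarrow> real) \<Rightarrow> real" where
  "gsup I S t g = (SUP s\<in>S. ip I (t s) g)"

definition gwidth :: "'i set \<Rightarrow> 's set \<Rightarrow> ('s \<Rightarrow> 'i \<Rightarrow> real) \<Rightarrow> real" where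
  "gwidth I S t = (\<integral>g. gsup I S t g \<partial>std_gaussian I)"

lemma prob_space_std_gaussian: "prob_space (std_gaussian I)"
  by (intro prob_space_PiM prob_space_normal_density) simp

lemma ip_Cauchy_Schwarz: "\<bar>ip I x y\<bar> \<le> sqrt (ip I x x) * sqrt (ip I y y)"
proof -
  have "(ip I x y)\<^sup>2 \<le> ip I x x * ip I y y"
    using Cauchy_Schwarz_ineq_sum[of x y I] by (simp add: ip_def power2_eq_square)
  then have "sqrt ((ip I x y)\<^sup>2) \<le> sqrt (ip I x x * ip I y y)" by (rule real_sqrt_le_mono)
  then show ?thesis by (simp add: real_sqrt_mult)
qed

lemma ip_measurable [measurable]: "ip I x \<in> borel_measurable (std_gaussian I)"
  unfolding ip_def by measurable

lemma std_gaussian_component: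
  fixes h :: "real \<Rightarrow> real"
  assumes "i \<in> I" "h \<in> borel_measurable borel"
  shows "integrable (std_gaussian I) (\<lambda>g. h (g i)) \<longleftrightarrow> integrable std_normal_distribution h"
    and "(\<integral>g. h (g i) \<partial>std_gaussian I) = (\<integral>x. h x \<partial>std_normal_distribution)"
proof -
  have D: "distr (std_gaussian I) std_normal_distribution (\<lambda>g. g i) = std_normal_distribution"
    using assms(1) by (intro distr_PiM_component prob_space_normal_density) auto
  have m: "(\<lambda>g. g i) \<in> std_gaussian I \<rightarrow>\<^sub>M std_normal_distribution"
    using assms(1) by measurable
  have h: "h \<in> borel_measurable std_normal_distribution" using assms(2) by simp
  show "integrable (std_gaussian I) (\<lambda>g. h (g i)) \<longleftrightarrow> integrable std_normal_distribution h"
    using integrable_distr_eq[OF m h] by (simp add: D)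
  show "(\<integral>g. h (g i) \<partial>std_gaussian I) = (\<integral>x. h x \<partial>std_normal_distribution)"
    using integral_distr[OF m h] by (simp add: D)
qed

lemma integrable_std_normal_power: "integrable std_normal_distribution (\<lambda>x. x ^ k)"
  using integrable_std_normal_moment[of k] by (subst integrable_density) auto

lemma integrable_ip_self: "integrable (std_gaussian I) (\<lambda>g. ip I g g)"
  unfolding ip_def using integrable_std_normal_power[of 2]
  by (intro Bochner_Integration.integrable_sum)
     (simp add: std_gaussian_component(1)[where h="\<lambda>x. x * x"] power2_eq_square)

lemma ip_self_measurable [measurable]: "(\<lambda>g. ip I g g) \<in> borel_measurable (std_gaussian I)"
  by (rule borel_measurable_integrable[OF integrable_ip_self])

lemma integrable_sqrt_ip: "integrable (std_gaussian I) (\<lambda>g. sqrt (ip I g g))"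
proof (rule Bochner_Integration.integrable_bound)
  interpret prob_space "std_gaussian I" by (rule prob_space_std_gaussian)
  show "integrable (std_gaussian I) (\<lambda>g. 1 + ip I g g)"
    by (intro Bochner_Integration.integrable_add integrable_ip_self) simp
  have "sqrt x \<le> 1 + x" if "0 \<le> x" for x
    using that by (intro real_le_lsqrt) (auto simp: power2_eq_square algebra_simps)
  then show "AE g in std_gaussian I. norm (sqrt (ip I g g)) \<le> norm (1 + ip I g g)"
    by (intro AE_I2) simp
qed measurable

lemma ip_le_bound:
  assumes "ip I x x \<le> B"
  shows "\<bar>ip I x g\<bar> \<le> sqrt B * sqrt (ip I g g)"
  by (rule order_trans[OF ip_Cauchy_Schwarz]) (use assms in \<open>simp add: mult_right_mono\<close>)

lemma bdd_above_ip:
  assumes "\<And>s. s \<in> S \<Longrightarrow> ip I (t s) (t s) \<le> B"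
  shows "bdd_above ((\<lambda>s. ip I (t s) g) ` S)"
  using ip_le_bound[OF assms] by (intro bdd_aboveI2[where M="sqrt B * sqrt (ip I g g)"]) (auto dest: abs_le_D1)

lemma ip_le_gsup:
  assumes "\<And>s. s \<in> S \<Longrightarrow> ip I (t s) (t s) \<le> B" "s \<in> S"
  shows "ip I (t s) g \<le> gsup I S t g"
  unfolding gsup_def by (rule cSUP_upper[OF assms(2) bdd_above_ip[OF assms(1)]])

lemma abs_gsup_le:
  assumes "S \<noteq> {}" "\<And>s. s \<in> S \<Longrightarrow> ip I (t s) (t s) \<le> B"
  shows "\<bar>gsup I S t g\<bar> \<le> sqrt B * sqrt (ip I g g)"
proof -
  obtain s where s: "s \<in> S" using assms(1) by auto
  have b: "\<bar>ip I (t s) g\<bar> \<le> sqrt B * sqrt (ip I g g)" if "s \<in> S" for s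
    using ip_le_bound[OF assms(2)] that by blast
  have "gsup I S t g \<le> sqrt B * sqrt (ip I g g)"
    unfolding gsup_def using b by (intro cSUP_least assms(1)) (auto dest: abs_le_D1)
  moreover have "- (sqrt B * sqrt (ip I g g)) \<le> gsup I S t g"
    using ip_le_gsup[of S I t B s g, OF assms(2) s] b[OF s] by linarith
  ultimately show ?thesis by linarith
qed

text \<open>\<open>S\<close> may be uncountable, but each set where the supremum exceeds
  \<open>a\<close> is a union of open half-spaces and hence open.\<close>

lemma gsup_measurable:
  fixes I :: "'i::countable set"
  assumes "finite I" "S \<noteq> {}" "\<And>s. s \<in> S \<Longrightarrow> ip I (t s) (t s) \<le> B"
  shows "gsup I S t \<in> borel_measurable (std_gaussian I)"
  unfolding borel_measurable_iff_greater
proof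
  fix a
  \<comment> \<open>Points of the product space are undefined outside \<open>I\<close>. Filling in
    zeros maps them into the full function space, whose Borel sets agree with the product
    sigma-algebra because the index type is countable.\<close>
  let ?e = "\<lambda>g i. if i \<in> I then g i else (0::real)"
  let ?U = "\<Union>s\<in>S. {g. a < ip I (t s) g}"
  have "open ?U"
    unfolding ip_def by (intro open_UN ballI open_Collect_less continuous_intros) auto
  then have U: "?U \<in> sets borel" by simp
  have e: "?e \<in> std_gaussian I \<rightarrow>\<^sub>M borel"
  proof -
    have "?e \<in> std_gaussian I \<rightarrow>\<^sub>M PiM UNIV (\<lambda>_. borel)"
    proof (rule measurable_PiM_single')
      show "(\<lambda>g. ?e g i) \<in> borel_measurable (std_gaussian I)" for i
        by (cases "i \<in> I") auto
    qed auto
    then show ?thesis by (simp cong: measurable_cong_sets add: sets_PiM_equal_borel)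
  qed
  have "{g \<in> space (std_gaussian I). a < gsup I S t g} = ?e -` ?U \<inter> space (std_gaussian I)"
  proof -
    have "a < gsup I S t g \<longleftrightarrow> (\<exists>s\<in>S. a < ip I (t s) g)" for g
      unfolding gsup_def by (rule less_cSUP_iff[OF assms(2) bdd_above_ip[OF assms(3)]])
    moreover have "ip I x (?e g) = ip I x g" for x g by (rule ip_cong) auto
    ultimately show ?thesis by auto
  qed
  then show "{g \<in> space (std_gaussian I). a < gsup I S t g} \<in> sets (std_gaussian I)"
    using measurable_sets[OF e U] by simp
qed

lemma integrable_gsup:
  fixes I :: "'i::countable set"
  assumes "finite I" "S \<noteq> {}" "\<And>s. s \<in> S \<Longrightarrow> ip I (t s) (t s) \<le> B"
  shows "integrable (std_gaussian I) (gsup I S t)"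
proof (rule Bochner_Integration.integrable_bound)
  show "integrable (std_gaussian I) (\<lambda>g. sqrt B * sqrt (ip I g g))"
    by (intro integrable_mult_right integrable_sqrt_ip)
  show "AE g in std_gaussian I. norm (gsup I S t g) \<le> norm (sqrt B * sqrt (ip I g g))"
  proof (rule AE_I2)
    fix g
    have "\<bar>gsup I S t g\<bar> \<le> sqrt B * sqrt (ip I g g)" by (rule abs_gsup_le[OF assms(2,3)])
    then show "norm (gsup I S t g) \<le> norm (sqrt B * sqrt (ip I g g))" by simp
  qed
qed (rule gsup_measurable[OF assms])

text \<open>The reflection is its own adjoint, so it can be moved from \<open>t\<close> to the
  Gaussian vector, whose law it preserves.\<close>

lemma gwidth_refl_along:
  fixes I :: "'i::countable set"
  assumes "finite I" "S \<noteq> {}" "\<And>s. s \<in> S \<Longrightarrow> ip I (t s) (t s) \<le> B"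
  shows "gwidth I S (\<lambda>s. refl_along I w (t s)) = gwidth I S t"
proof -
  have "gwidth I S t = (\<integral>g. gsup I S t g \<partial>distr (std_gaussian I) (std_gaussian I) (refl_along I w))"
    by (simp add: gwidth_def distr_std_gaussian_refl_along[OF assms(1)])
  also have "\<dots> = (\<integral>g. gsup I S t (refl_along I w g) \<partial>std_gaussian I)"
    by (rule integral_distr) (use gsup_measurable[OF assms] in measurable)
  also have "\<dots> = gwidth I S (\<lambda>s. refl_along I w (t s))"
    by (simp add: gwidth_def gsup_def ip_refl_along_adjoint[OF assms(1)])
  finally show ?thesis by (rule sym)
qed

section \<open>Dependence of the expected supremum on the covariance alone\<close>

lemma gsup_cong:
  "(\<And>s i. s \<in> S \<Longrightarrow> i \<in> I \<Longrightarrow> t s i = u s i) \<Longrightarrow> gsup I S t = gsup I S u"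
  unfolding gsup_def by (intro ext SUP_cong ip_cong) auto

lemma gwidth_cong:
  "(\<And>s i. s \<in> S \<Longrightarrow> i \<in> I \<Longrightarrow> t s i = u s i) \<Longrightarrow> gwidth I S t = gwidth I S u"
  unfolding gwidth_def using gsup_cong[of S I t u] by simp

text \<open>Coordinates on which the whole family vanishes do not contribute, and the remaining
  marginal of a product measure is again the product. This allows families over different index
  types to be placed in one space.\<close>

lemma gwidth_pad:
  fixes I :: "'i::countable set" and K :: "'k set"
  assumes "finite I" "S \<noteq> {}" "\<And>s. s \<in> S \<Longrightarrow> ip I (t s) (t s) \<le> B"
    and "finite K" "inj_on f I" "f ` I \<subseteq> K"
    and eq: "\<And>s i. s \<in> S \<Longrightarrow> i \<in> I \<Longrightarrow> u s (f i) = t s i"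
    and zero: "\<And>s k. s \<in> S \<Longrightarrow> k \<in> K - f ` I \<Longrightarrow> u s k = 0"
  shows "gwidth K S u = gwidth I S t"
proof -
  let ?r = "\<lambda>g. \<lambda>i\<in>I. g (f i)"
  have D: "distr (std_gaussian K) (std_gaussian I) ?r = std_gaussian I"
    by (rule distr_PiM_reindex[where M="\<lambda>_. std_normal_distribution", simplified])
      (use assms in \<open>auto intro: prob_space_normal_density\<close>)
  have m: "?r \<in> std_gaussian K \<rightarrow>\<^sub>M std_gaussian I"
    using assms(6) by (intro measurable_restrict measurable_component_singleton) auto
  have ipr: "ip K (u s) g = ip I (t s) (?r g)" if "s \<in> S" for s g
  proof -
    have "ip K (u s) g = (\<Sum>k\<in>f ` I. u s k * g k)"
      unfolding ip_def by (rule sum.mono_neutral_right) (use assms that in auto)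
    also have "\<dots> = ip I (t s) (?r g)"
      using assms(5) eq that by (simp add: ip_def sum.reindex)
    finally show ?thesis .
  qed
  have "gwidth I S t = (\<integral>g. gsup I S t g \<partial>distr (std_gaussian K) (std_gaussian I) ?r)"
    by (simp add: gwidth_def D)
  also have "\<dots> = (\<integral>g. gsup I S t (?r g) \<partial>std_gaussian K)"
    by (rule integral_distr[OF m gsup_measurable[OF assms(1-3)]])
  also have "\<dots> = gwidth K S u"
    unfolding gwidth_def gsup_def using ipr by (simp cong: SUP_cong_simp)
  finally show ?thesis by (rule sym)
qed

text \<open>Gaussian elimination: a member \<open>z\<close> with a nonzero entry at \<open>j\<close>
  clears coordinate \<open>j\<close> from all the others, and the induction treats the remaining
  coordinates.\<close>

lemma finite_spanning_subset:
  fixes t :: "'s \<Rightarrow> 'i \<Rightarrow> real"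
  assumes "finite I"
  shows "\<exists>F\<subseteq>S. finite F \<and> (\<forall>s\<in>S. \<exists>c. \<forall>i\<in>I. t s i = (\<Sum>f\<in>F. c f * t f i))"
  using assms
proof (induction I arbitrary: t rule: finite_induct)
  case empty
  then show ?case by (intro exI[of _ "{}"]) auto
next
  case (insert j I)
  show ?case
  proof (cases "\<forall>s\<in>S. t s j = 0")
    case True
    obtain F where F: "F \<subseteq> S" "finite F" "\<forall>s\<in>S. \<exists>c. \<forall>i\<in>I. t s i = (\<Sum>f\<in>F. c f * t f i)"
      using insert.IH[of t] by blast
    have "(\<Sum>f\<in>F. c f * t f j) = 0" for c :: "'s \<Rightarrow> real"
      using True F(1) by (intro sum.neutral) auto
    then have "\<exists>c. \<forall>i\<in>insert j I. t s i = (\<Sum>f\<in>F. c f * t f i)" if "s \<in> S" for s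
      using F(3) True that by (metis insertE)
    then show ?thesis using F by blast
  next
    case False
    then obtain z where z: "z \<in> S" "t z j \<noteq> 0" by auto
    define t' where "t' = (\<lambda>s i. t s i - t s j / t z j * t z i)"
    obtain F where F: "F \<subseteq> S" "finite F" "\<forall>s\<in>S. \<exists>c. \<forall>i\<in>I. t' s i = (\<Sum>f\<in>F. c f * t' f i)"
      using insert.IH[of t'] by blast
    have "\<exists>c. \<forall>i\<in>insert j I. t s i = (\<Sum>f\<in>insert z F. c f * t f i)" if "s \<in> S" for s
    proof -
      from F(3) that have "\<exists>c. \<forall>i\<in>I. t' s i = (\<Sum>f\<in>F. c f * t' f i)" by (rule bspec)
      then obtain c where c: "\<forall>i\<in>I. t' s i = (\<Sum>f\<in>F. c f * t' f i)" by (rule exE)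
      \<comment> \<open>\<open>b\<close> collects the multiples of \<open>t z\<close> that the
        elimination subtracted. In \<open>d\<close> it is added to the old coefficient, since
        \<open>z\<close> may already belong to \<open>F\<close>.\<close>
      define b where "b = t s j / t z j - (\<Sum>f\<in>F. c f * (t f j / t z j))"
      define d where "d = (\<lambda>f. (if f \<in> F then c f else 0) + (if f = z then b else 0))"
      have *: "\<forall>i\<in>insert j I. t' s i = (\<Sum>f\<in>F. c f * t' f i)"
        using c z by (auto simp: t'_def)
      have "t s i = (\<Sum>f\<in>F. c f * t f i) + b * t z i" if "i \<in> insert j I" for i
      proof -
        have "(\<Sum>f\<in>F. c f * t' f i) = (\<Sum>f\<in>F. c f * t f i) - (\<Sum>f\<in>F. c f * (t f j / t z j)) * t z i"
          unfolding t'_def right_diff_distrib sum_subtractf sum_distrib_right by (simp add: mult.assoc)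
        moreover have "t' s i = (\<Sum>f\<in>F. c f * t' f i)" using * that by blast
        ultimately show ?thesis by (simp add: b_def t'_def left_diff_distrib)
      qed
      moreover have "(\<Sum>f\<in>insert z F. d f * t f i) = (\<Sum>f\<in>F. c f * t f i) + b * t z i" for i
      proof -
        have "(\<Sum>f\<in>insert z F. (if f \<in> F then c f else 0) * t f i) = (\<Sum>f\<in>F. c f * t f i)"
          using F(2) by (intro sum.mono_neutral_cong_right) auto
        moreover have "(\<Sum>f\<in>insert z F. (if f = z then b else 0) * t f i) = (\<Sum>f\<in>{z}. b * t f i)"
          using F(2) by (intro sum.mono_neutral_cong_right) auto
        ultimately show ?thesis by (simp add: d_def distrib_right sum.distrib)
      qed
      ultimately show ?thesis by (intro exI[of _ d]) auto
    qed
    then show ?thesis using F z by (intro exI[of _ "insert z F"]) auto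
  qed
qed

text \<open>The right-hand side involves only entries of the Gram matrix. Hence a linear relation
  that holds in one family also holds in any other family with the same Gram matrix.\<close>

lemma ip_combination_diff:
  assumes "finite F"
  shows "ip I (\<lambda>i. t s i - (\<Sum>f\<in>F. c f * t f i)) (\<lambda>i. t s i - (\<Sum>f\<in>F. c f * t f i)) =
    ip I (t s) (t s) - 2 * (\<Sum>f\<in>F. c f * ip I (t s) (t f)) + (\<Sum>f\<in>F. \<Sum>h\<in>F. c f * c h * ip I (t f) (t h))"
proof -
  have sumr: "ip I x (\<lambda>i. \<Sum>f\<in>F. c f * t f i) = (\<Sum>f\<in>F. c f * ip I x (t f))" for x
    unfolding ip_def sum_distrib_left by (subst sum.swap) (simp add: mult.left_commute)
  have suml: "ip I (\<lambda>i. \<Sum>f\<in>F. c f * t f i) x = (\<Sum>f\<in>F. c f * ip I (t f) x)" for x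
    unfolding ip_commute[of I _ x] by (rule sumr)
  have diffr: "ip I z (\<lambda>i. x i - y i) = ip I z x - ip I z y" for x y z
    unfolding ip_commute[of I z] by (rule ip_diff_left)
  let ?y = "\<lambda>i. \<Sum>f\<in>F. c f * t f i"
  have "ip I (\<lambda>i. t s i - ?y i) (\<lambda>i. t s i - ?y i) = ip I (t s) (t s) - 2 * ip I (t s) ?y + ip I ?y ?y"
    unfolding ip_diff_left diffr using ip_commute[of I ?y "t s"] by simp
  also have "ip I ?y ?y = (\<Sum>f\<in>F. \<Sum>h\<in>F. c f * c h * ip I (t f) (t h))"
    unfolding suml sumr by (simp add: sum_distrib_left mult.assoc)
  finally show ?thesis unfolding sumr .
qed

text \<open>A reflection moves \<open>t f\<close> to \<open>u f\<close> and fixes the vectors moved before, by equality of the Gram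
  matrices. After a finite spanning subset has been moved, everything has been moved.\<close>

lemma gwidth_gram_cong_same:
  fixes K :: "'k::countable set"
  assumes K: "finite K" and S: "S \<noteq> {}" and B: "\<And>s. s \<in> S \<Longrightarrow> ip K (t s) (t s) \<le> B"
    and gram: "\<And>s s'. s \<in> S \<Longrightarrow> s' \<in> S \<Longrightarrow> ip K (t s) (t s') = ip K (u s) (u s')"
  shows "gwidth K S t = gwidth K S u"
proof -
  have moved: "\<exists>v. (\<forall>s\<in>S. \<forall>s'\<in>S. ip K (v s) (v s') = ip K (u s) (u s')) \<and>
      (\<forall>f\<in>F. \<forall>k\<in>K. v f k = u f k) \<and> gwidth K S v = gwidth K S t"
    if "finite F" "F \<subseteq> S" for F
    using that
  proof (induction F rule: finite_induct)
    case empty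
    then show ?case using gram by (intro exI[of _ t]) auto
  next
    case (insert f F)
    have f: "f \<in> S" "F \<subseteq> S" using insert.prems by auto
    from insert.IH[OF f(2)] obtain v where v: "\<And>s s'. s \<in> S \<Longrightarrow> s' \<in> S \<Longrightarrow> ip K (v s) (v s') = ip K (u s) (u s')"
      "\<And>f k. f \<in> F \<Longrightarrow> k \<in> K \<Longrightarrow> v f k = u f k" "gwidth K S v = gwidth K S t" by blast
    define w where "w = (\<lambda>k. v f k - u f k)"
    define v' where "v' = (\<lambda>s. refl_along K w (v s))"
    have "v' h k = u h k" if "h \<in> insert f F" "k \<in> K" for h k
    proof (cases "h = f")
      case True
      then show ?thesis unfolding v'_def w_def
        using refl_along_diff_eq[OF K v(1)[OF f(1) f(1)] that(2)] by simp
    next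
      case False
      then have h: "h \<in> F" "h \<in> S" using that f by auto
      have "ip K w (v h) = ip K (v f) (v h) - ip K (u f) (v h)" by (simp add: w_def ip_diff_left)
      also have "ip K (u f) (v h) = ip K (u f) (u h)" by (rule ip_cong) (use v(2) h in auto)
      finally have "ip K w (v h) = 0" using v(1) h f by simp
      then show ?thesis using v(2) h that by (simp add: v'_def refl_along_def)
    qed
    moreover have "ip K (v' s) (v' s') = ip K (u s) (u s')" if "s \<in> S" "s' \<in> S" for s s'
      using v(1) that by (simp add: v'_def ip_refl_along_isometry[OF K])
    moreover have "gwidth K S v' = gwidth K S t"
      unfolding v'_def v(3)[symmetric]
      by (rule gwidth_refl_along[OF K S, where B=B]) (use v(1) gram B in auto)
    ultimately show ?case by (intro exI[of _ v']) auto
  qed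
  obtain F where F: "F \<subseteq> S" "finite F" "\<And>s. s \<in> S \<Longrightarrow> \<exists>c. \<forall>i\<in>K. u s i = (\<Sum>f\<in>F. c f * u f i)"
    using finite_spanning_subset[OF K, of S u] by blast
  obtain v where v: "\<And>s s'. s \<in> S \<Longrightarrow> s' \<in> S \<Longrightarrow> ip K (v s) (v s') = ip K (u s) (u s')"
    "\<And>f k. f \<in> F \<Longrightarrow> k \<in> K \<Longrightarrow> v f k = u f k" "gwidth K S v = gwidth K S t"
    using moved[OF F(2,1)] by blast
  have "v s k = u s k" if s: "s \<in> S" and k: "k \<in> K" for s k
  proof -
    from F(3)[OF s] obtain c where c: "\<And>i. i \<in> K \<Longrightarrow> u s i = (\<Sum>f\<in>F. c f * u f i)" by blast
    \<comment> \<open>\<open>u s\<close> is a combination of the spanning vectors. The corresponding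
      residual for \<open>v\<close> has the same norm, namely zero, so \<open>v s\<close> is the
      same combination of vectors that have already been moved.\<close>
    have "ip K (\<lambda>i. v s i - (\<Sum>f\<in>F. c f * v f i)) (\<lambda>i. v s i - (\<Sum>f\<in>F. c f * v f i)) =
        ip K (\<lambda>i. u s i - (\<Sum>f\<in>F. c f * u f i)) (\<lambda>i. u s i - (\<Sum>f\<in>F. c f * u f i))"
    proof -
      have "ip K (v h) (v h') = ip K (u h) (u h')" if "h \<in> insert s F" "h' \<in> insert s F" for h h'
        using v(1) s F(1) that by blast
      then show ?thesis unfolding ip_combination_diff[OF F(2)] by simp
    qed
    also have "\<dots> = ip K (\<lambda>_. 0) (\<lambda>_. 0)" by (rule ip_cong) (use c in auto)
    finally have "ip K (\<lambda>i. v s i - (\<Sum>f\<in>F. c f * v f i)) (\<lambda>i. v s i - (\<Sum>f\<in>F. c f * v f i)) = 0"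
      by (simp add: ip_def)
    with k have "v s k = (\<Sum>f\<in>F. c f * v f k)" by (simp add: ip_self_eq_0[OF K])
    also have "\<dots> = u s k" using v(2) c k by simp
    finally show ?thesis .
  qed
  then have "gwidth K S v = gwidth K S u" by (rule gwidth_cong)
  then show ?thesis using v(3) by simp
qed

text \<open>Both families are padded with zeros into the sum of the two index sets. There they have
  equal Gram matrices in a single space, so reflections can carry one to the other.\<close>

theorem gwidth_gram_cong:
  fixes I :: "'i::countable set" and J :: "'j::countable set"
  assumes I: "finite I" and J: "finite J" and S: "S \<noteq> {}"
    and B: "\<And>s. s \<in> S \<Longrightarrow> ip I (t s) (t s) \<le> B"
    and gram: "\<And>s s'. s \<in> S \<Longrightarrow> s' \<in> S \<Longrightarrow> ip I (t s) (t s') = ip J (u s) (u s')"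
  shows "gwidth I S t = gwidth J S u"
proof -
  let ?K = "Inl ` I \<union> Inr ` J"
  let ?t = "\<lambda>s. case_sum (t s) (\<lambda>_. 0)" and ?u = "\<lambda>s. case_sum (\<lambda>_. 0) (u s)"
  have disj: "Inl ` I \<inter> Inr ` J = {}" by auto
  have ipt: "ip ?K (?t s) (?t s') = ip I (t s) (t s')" for s s'
    unfolding ip_def using I J disj by (subst sum.union_disjoint) (auto simp: sum.reindex)
  have ipu: "ip ?K (?u s) (?u s') = ip J (u s) (u s')" for s s'
    unfolding ip_def using I J disj by (subst sum.union_disjoint) (auto simp: sum.reindex)
  have "gwidth I S t = gwidth ?K S ?t"
    by (rule gwidth_pad[OF I S B, symmetric, where f=Inl]) (use I J in auto)
  also have "\<dots> = gwidth ?K S ?u"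
    by (rule gwidth_gram_cong_same[where B=B]) (use I J S B gram ipt ipu in auto)
  also have "\<dots> = gwidth J S u"
    by (rule gwidth_pad[OF J S, where f=Inr and B=B]) (use I J B gram in auto)
  finally show ?thesis .
qed

section \<open>The norm of a Gaussian vector\<close>

lemma integral_ip_self: "finite I \<Longrightarrow> (\<integral>g. ip I g g \<partial>std_gaussian I) = card I"
proof -
  assume "finite I"
  have i: "integrable (std_gaussian I) (\<lambda>g. (g i)\<^sup>2)" "(\<integral>g. (g i)\<^sup>2 \<partial>std_gaussian I) = 1" if "i \<in> I" for i
    using std_gaussian_component[OF that, of "\<lambda>x. x\<^sup>2"] integrable_std_normal_power[of 2]
      std_normal_distribution_even_moments(1)[of 1] by (auto simp: fact_numeral)
  have "(\<integral>g. ip I g g \<partial>std_gaussian I) = (\<Sum>i\<in>I. \<integral>g. (g i)\<^sup>2 \<partial>std_gaussian I)"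
    unfolding ip_def power2_eq_square[symmetric] by (rule Bochner_Integration.integral_sum) (rule i)
  then show ?thesis using i by simp
qed

lemma
  fixes I :: "'i set"
  assumes "finite I"
  shows integrable_ip_self_square: "integrable (std_gaussian I) (\<lambda>g. (ip I g g)\<^sup>2)"
    and integral_ip_self_square: "(\<integral>g. (ip I g g)\<^sup>2 \<partial>std_gaussian I) = (real (card I))\<^sup>2 + 2 * card I"
proof -
  \<comment> \<open>\<open>h i j k\<close> is the factor contributed by coordinate \<open>k\<close>
    to the monomial with squares at \<open>i\<close> and \<open>j\<close>. Independence turns the
    expectation into a product of one-dimensional moments, covering \<open>i = j\<close> and
    \<open>i \<noteq> j\<close> together.\<close>
  define h where "h = (\<lambda>(i::'i) (j::'i) (k::'i) x. (if k = i then x\<^sup>2 else 1) * (if k = j then x\<^sup>2 else (1::real)))"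
  have prob: "prob_space std_normal_distribution" by (rule prob_space_normal_density) simp
  interpret N: prob_space std_normal_distribution by (rule prob)
  have h_eq: "h i j k = (if k = i then if k = j then \<lambda>x. x ^ 4 else (\<lambda>x. x ^ 2) else if k = j then \<lambda>x. x ^ 2 else (\<lambda>x. 1))" for i j k
    by (auto simp: h_def fun_eq_iff power2_eq_square power4_eq_xxxx)
  have hi: "integrable std_normal_distribution (h i j k)" for i j k
    unfolding h_eq using integrable_std_normal_power[of 2] integrable_std_normal_power[of 4] by auto
  have hv: "(\<integral>x. h i j k x \<partial>std_normal_distribution) = (if k = i then if i = j then 3 else 1 else 1)" for i j k
    unfolding h_eq using std_normal_distribution_even_moments(1)[of 1] std_normal_distribution_even_moments(1)[of 2]
    using N.prob_space by (auto simp: fact_numeral)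
  have prod: "(\<Prod>k\<in>I. h i j k (g k)) = (g i)\<^sup>2 * (g j)\<^sup>2" if "i \<in> I" "j \<in> I" for i j g
    using that assms by (simp add: h_def prod.distrib)
  have int: "integrable (std_gaussian I) (\<lambda>g. (g i)\<^sup>2 * (g j)\<^sup>2)" if "i \<in> I" "j \<in> I" for i j
    unfolding prod[OF that, symmetric] by (rule normal_product.product_integrable_prod[OF assms hi])
  have val: "(\<integral>g. (g i)\<^sup>2 * (g j)\<^sup>2 \<partial>std_gaussian I) = (if i = j then 3 else 1)" if "i \<in> I" "j \<in> I" for i j
    unfolding prod[OF that, symmetric] normal_product.product_integral_prod[OF assms hi] hv
    using assms that by simp
  have sq: "(ip I g g)\<^sup>2 = (\<Sum>i\<in>I. \<Sum>j\<in>I. (g i)\<^sup>2 * (g j)\<^sup>2)" for g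
    unfolding ip_def power2_eq_square[symmetric] unfolding power2_eq_square[of "sum _ _"] sum_product ..
  show "integrable (std_gaussian I) (\<lambda>g. (ip I g g)\<^sup>2)"
    unfolding sq by (intro Bochner_Integration.integrable_sum int)
  have "(\<integral>g. (ip I g g)\<^sup>2 \<partial>std_gaussian I) = (\<Sum>i\<in>I. \<integral>g. (\<Sum>j\<in>I. (g i)\<^sup>2 * (g j)\<^sup>2) \<partial>std_gaussian I)"
    unfolding sq by (rule Bochner_Integration.integral_sum) (intro Bochner_Integration.integrable_sum int)
  also have "\<dots> = (\<Sum>i\<in>I. \<Sum>j\<in>I. \<integral>g. (g i)\<^sup>2 * (g j)\<^sup>2 \<partial>std_gaussian I)"
    by (intro sum.cong refl Bochner_Integration.integral_sum int)
  also have "\<dots> = (\<Sum>i\<in>I. \<Sum>j\<in>I. 1 + (if i = j then 2 else 0))"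
    by (intro sum.cong refl) (simp add: val)
  also have "\<dots> = (\<Sum>i\<in>I. real (card I) + 2)"
    using assms by (intro sum.cong refl) (simp add: sum.distrib)
  also have "\<dots> = (real (card I))\<^sup>2 + 2 * card I"
    by (simp add: power2_eq_square distrib_left)
  finally show "(\<integral>g. (ip I g g)\<^sup>2 \<partial>std_gaussian I) = (real (card I))\<^sup>2 + 2 * card I" .
qed

text \<open>The bound touches at \<open>x = 1\<close>, where the normalized squared norm of a Gaussian vector concentrates.\<close>

lemma sqrt_ge_quadratic:
  assumes "0 \<le> x"
  shows "(3 * x - x\<^sup>2) / 2 \<le> sqrt x"
proof -
  define s where "s = sqrt x"
  have s: "0 \<le> s" "x = s\<^sup>2" using assms by (auto simp: s_def)
  have "0 \<le> s * ((s - 1)\<^sup>2 * (s + 2))" using s by simp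
  then have "3 * s\<^sup>2 - (s\<^sup>2)\<^sup>2 \<le> 2 * s" by (simp add: power2_eq_square algebra_simps)
  then show ?thesis using s(1) by (simp add: s(2))
qed

text \<open>The quadratic minorant is applied to \<open>ip I g g / n\<close>. This has mean 1 and
  second moment \<open>1 + 2 / n\<close>, which gives
  \<open>sqrt n * (3 - (1 + 2 / n)) / 2 = sqrt n - 1 / sqrt n\<close>.\<close>

lemma integral_norm_gaussian_ge:
  assumes "finite I" "I \<noteq> {}"
  shows "sqrt (card I) - 1 / sqrt (card I) \<le> (\<integral>g. sqrt (ip I g g) \<partial>std_gaussian I)"
proof -
  define n where "n = real (card I)"
  have n: "0 < n" using assms by (simp add: n_def card_gt_0_iff)
  let ?f = "\<lambda>g. sqrt n * ((3 * (ip I g g / n) - (ip I g g)\<^sup>2 / n\<^sup>2) / 2)"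
  have int: "integrable (std_gaussian I) (\<lambda>g. 3 * (ip I g g / n) - (ip I g g)\<^sup>2 / n\<^sup>2)"
    by (intro Bochner_Integration.integrable_diff integrable_mult_right integrable_divide
        integrable_ip_self integrable_ip_self_square assms)
  have "sqrt n - 1 / sqrt n = sqrt n * ((3 * (n / n) - (n\<^sup>2 + 2 * n) / n\<^sup>2) / 2)"
  proof -
    have "s - 1 / s = s * ((3 * (s\<^sup>2 / s\<^sup>2) - ((s\<^sup>2)\<^sup>2 + 2 * s\<^sup>2) / (s\<^sup>2)\<^sup>2) / 2)" if "0 < s" for s :: real
      using that by (simp add: field_simps power2_eq_square)
    from this[of "sqrt n"] n show ?thesis by simp
  qed
  also have "\<dots> = sqrt n * ((\<integral>g. 3 * (ip I g g / n) - (ip I g g)\<^sup>2 / n\<^sup>2 \<partial>std_gaussian I) / 2)"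
    by (subst Bochner_Integration.integral_diff)
      (auto intro!: integrable_mult_right integrable_divide integrable_ip_self integrable_ip_self_square
        simp: integral_ip_self integral_ip_self_square assms n_def)
  also have "\<dots> = (\<integral>g. ?f g \<partial>std_gaussian I)" by simp
  also have "\<dots> \<le> (\<integral>g. sqrt (ip I g g) \<partial>std_gaussian I)"
  proof (rule integral_mono)
    show "integrable (std_gaussian I) ?f"
      by (intro integrable_mult_right integrable_divide int)
    show "integrable (std_gaussian I) (\<lambda>g. sqrt (ip I g g))" by (rule integrable_sqrt_ip)
    fix g
    have "?f g \<le> sqrt n * sqrt (ip I g g / n)"
      using sqrt_ge_quadratic[of "ip I g g / n"] n by (intro mult_left_mono) (auto simp: power_divide)
    also have "\<dots> = sqrt (ip I g g)" using n by (simp add: real_sqrt_divide)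
    finally show "?f g \<le> sqrt (ip I g g)" .
  qed
  finally show ?thesis by (simp add: n_def)
qed

section \<open>Processes on spheres with polynomial covariance\<close>

text \<open>Words index the monomials in the coordinates of a vector. The set \<open>Q\<close> of
  admissible degrees makes it possible to split off the degree-one part.\<close>

definition words :: "'a set \<Rightarrow> nat set \<Rightarrow> 'a list set" where
  "words A Q = {is. set is \<subseteq> A \<and> length is \<in> Q}"

lemma words_UN: "words A Q = (\<Union>p\<in>Q. {is. set is \<subseteq> A \<and> length is = p})"
  by (auto simp: words_def)

lemma finite_words: "finite A \<Longrightarrow> finite Q \<Longrightarrow> finite (words A Q)"
  unfolding words_UN by (intro finite_UN_I finite_lists_length_eq)

lemma words_singleton_1: "words A {1} = (\<lambda>i. [i]) ` A"
  by (auto simp: words_def length_Suc_conv)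

lemma sum_prod_list_words:
  fixes x :: "'a \<Rightarrow> real"
  assumes "finite A"
  shows "(\<Sum>is | set is \<subseteq> A \<and> length is = p. prod_list (map x is)) = (\<Sum>i\<in>A. x i) ^ p"
proof (induction p)
  case 0
  have "{is. set is \<subseteq> A \<and> length is = 0} = {[]}" by auto
  then show ?case by simp
next
  case (Suc p)
  have inj: "inj_on (\<lambda>(xs, n). n # xs) ({is. set is \<subseteq> A \<and> length is = p} \<times> A)"
    by (auto simp: inj_on_def)
  show ?case
    unfolding lists_length_Suc_eq sum.reindex[OF inj]
    unfolding power_Suc2 Suc.IH[symmetric] sum_product sum.cartesian_product
    by (rule sum.cong[OF refl]) auto
qed

lemma sum_words:
  assumes "finite A" "finite Q"
  shows "(\<Sum>is\<in>words A Q. f is) = (\<Sum>p\<in>Q. \<Sum>is | set is \<subseteq> A \<and> length is = p. f is)"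
  unfolding words_UN using assms by (intro sum.UNION_disjoint) (auto intro: finite_lists_length_eq)

lemma prod_list_map_mult:
  "prod_list (map x is) * prod_list (map y is) = prod_list (map (\<lambda>i. x i * y i :: real) is)"
  by (induction "is") (auto simp: algebra_simps)

text \<open>The inner product of two tensor powers is the power of the inner product; this is what
  produces polynomial covariances.\<close>

lemma ip_words:
  fixes y z :: "'a \<Rightarrow> real"
  assumes "finite A" "finite Q"
  shows "ip (words A Q) (\<lambda>is. a (length is) * prod_list (map y is)) (\<lambda>is. b (length is) * prod_list (map z is)) =
    (\<Sum>p\<in>Q. a p * b p * ip A y z ^ p)"
proof -
  have "(\<Sum>is | set is \<subseteq> A \<and> length is = p. (a (length is) * prod_list (map y is)) * (b (length is) * prod_list (map z is)))
      = (\<Sum>is | set is \<subseteq> A \<and> length is = p. a p * b p * prod_list (map (\<lambda>i. y i * z i) is))" for p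
    by (rule sum.cong[OF refl]) (auto simp flip: prod_list_map_mult)
  then show ?thesis
    unfolding ip_def sum_words[OF assms] sum_prod_list_words[OF assms(1), symmetric]
    by (simp add: sum_distrib_left)
qed

text \<open>The feature map of the kernel \<open>poly k (ip A y z)\<close>. Nonnegative coefficients
  are what makes the square roots multiply back to the coefficients of \<open>k\<close>.\<close>

definition feature :: "real poly \<Rightarrow> ('a \<Rightarrow> real) \<Rightarrow> 'a list \<Rightarrow> real" where
  "feature k y is = sqrt (coeff k (length is)) * prod_list (map y is)"

definition nonneg_coeffs :: "real poly \<Rightarrow> bool" where
  "nonneg_coeffs k \<longleftrightarrow> (\<forall>i. 0 \<le> coeff k i)"

text \<open>The bound \<open>Suc (degree k)\<close> instead of \<open>degree k\<close> makes words of length one available even for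
  constant \<open>k\<close>.\<close>

definition sphere_width :: "real poly \<Rightarrow> 'a set \<Rightarrow> real \<Rightarrow> real" where
  "sphere_width k A r = gwidth (words A {..Suc (degree k)}) {y. ip A y y = r} (feature k)"

lemma ip_feature:
  assumes "finite A" "finite Q" "nonneg_coeffs k"
  shows "ip (words A Q) (feature k y) (feature k z) = (\<Sum>p\<in>Q. coeff k p * ip A y z ^ p)"
  using ip_words[OF assms(1,2), of "\<lambda>p. sqrt (coeff k p)" y "\<lambda>p. sqrt (coeff k p)" z] assms(3)
  by (simp add: feature_def[abs_def] nonneg_coeffs_def)

lemma poly_as_sum: "degree k \<le> n \<Longrightarrow> poly k x = (\<Sum>p\<le>n. coeff k p * x ^ p)" for k :: "real poly"
  unfolding poly_altdef by (intro sum.mono_neutral_left) (auto simp: coeff_eq_0)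

lemma ip_feature_poly:
  assumes "finite A" "nonneg_coeffs k"
  shows "ip (words A {..Suc (degree k)}) (feature k y) (feature k z) = poly k (ip A y z)"
  using ip_feature[OF assms(1) _ assms(2), of "{..Suc (degree k)}" y z] poly_as_sum[of k "Suc (degree k)" "ip A y z"]
  by simp

text \<open>Keeps the covariance in the same class after a step, so that the step can be iterated.
  Horner's scheme adds and multiplies only nonnegative coefficients when \<open>d\<close> is
  nonnegative.\<close>

lemma nonneg_coeffs_pcompose:
  assumes "nonneg_coeffs k" "0 \<le> d"
  shows "nonneg_coeffs (pcompose k [:d, 1:])"
  using assms(1)
proof (induction k)
  case 0
  then show ?case by simp
next
  case (pCons a k)
  have "0 \<le> a" "nonneg_coeffs k"
    using pCons.prems unfolding nonneg_coeffs_def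
    by (metis coeff_pCons_0, metis coeff_pCons_Suc)
  with pCons.IH show ?case
    using assms(2) by (auto simp: nonneg_coeffs_def pcompose_pCons coeff_pCons split: nat.split)
qed

lemma nonempty_sphere:
  assumes "finite A" "A \<noteq> {}" "0 \<le> r"
  shows "{y. ip A y y = r} \<noteq> {}"
proof -
  obtain a where a: "a \<in> A" using assms by auto
  have "ip A (\<lambda>i. if i = a then sqrt r else 0) (\<lambda>i. if i = a then sqrt r else 0) = (\<Sum>i\<in>{a}. r)"
    unfolding ip_def by (rule sum.mono_neutral_cong_right) (use assms a in auto)
  then show ?thesis by auto
qed

text \<open>\<open>R\<close> is the reflection exchanging \<open>g\<close> with the multiple of the
  axis \<open>a\<close> of the same length. Vectors orthogonal to \<open>g\<close> then correspond
  to vectors without coordinate \<open>a\<close>, so a step can delete an index instead of working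
  in a random subspace.\<close>

lemma exists_isometry_to_axis:
  assumes "finite A" "a \<in> A"
  obtains R where "\<And>x y. ip A (R x) (R y) = ip A x y"
    and "\<And>y. ip A (R y) g = y a * sqrt (ip A g g)"
proof
  let ?e = "\<lambda>i. if i = a then sqrt (ip A g g) else 0"
  let ?R = "refl_along A (\<lambda>i. g i - ?e i)"
  have e: "ip A y ?e = y a * sqrt (ip A g g)" for y
    using assms by (simp add: ip_def if_distrib[where f="\<lambda>x. _ * x"] cong: if_cong)
  have "ip A ?e ?e = ip A g g" using e[of ?e] by simp
  then have Rg: "?R g i = ?e i" if "i \<in> A" for i
    using refl_along_diff_eq[OF assms(1) _ that, of g ?e] by simp
  show "ip A (?R x) (?R y) = ip A x y" for x y by (rule ip_refl_along_isometry[OF assms(1)])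
  show "ip A (?R y) g = y a * sqrt (ip A g g)" for y
  proof -
    have "ip A (?R y) g = ip A y (?R g)" by (rule ip_refl_along_adjoint[OF assms(1)])
    also have "\<dots> = ip A y ?e" by (rule ip_cong) (use Rg in auto)
    finally show ?thesis using e by simp
  qed
qed

text \<open>The covariance, as a function of the inner product of the remaining components, after a step of
  squared length \<open>d\<close> along the degree-one part, which itself is removed.\<close>

definition descend :: "real \<Rightarrow> real poly \<Rightarrow> real poly" where
  "descend d k = pcompose (k - [:0, coeff k 1:]) [:d, 1:]"

lemma nonneg_coeffs_descend: "nonneg_coeffs k \<Longrightarrow> 0 \<le> d \<Longrightarrow> nonneg_coeffs (descend d k)"
  unfolding descend_def
  by (rule nonneg_coeffs_pcompose) (auto simp: nonneg_coeffs_def coeff_pCons split: nat.split)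

lemma poly_descend: "poly (descend d k) x = poly k (d + x) - coeff k 1 * (d + x)"
  by (simp add: descend_def poly_pcompose algebra_simps)

lemma poly_pderiv_descend: "poly (pderiv (descend d k)) x = poly (pderiv k) (d + x) - coeff k 1"
  by (simp add: descend_def pderiv_pcompose pderiv_diff poly_pcompose pderiv_pCons)

text \<open>On the sphere of radius zero all vectors agree on \<open>A\<close>, so the supremum is a
  single Gaussian variable, and this has mean zero. It is the end of the descent.\<close>

lemma sphere_width_zero_nonneg:
  assumes "finite A" "nonneg_coeffs k"
  shows "0 \<le> sphere_width k A 0"
proof -
  let ?I = "words A {..Suc (degree k)}"
  have "gsup ?I {y. ip A y y = 0} (feature k) = (\<lambda>g. ip ?I (feature k (\<lambda>_. 0)) g)"
  proof
    fix g
    have "ip ?I (feature k y) g = ip ?I (feature k (\<lambda>_. 0)) g" if "ip A y y = 0" for y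
    proof (rule ip_cong)
      fix "is" assume "is \<in> ?I"
      then have "map y is = map (\<lambda>_. 0) is"
        using that assms(1) by (auto simp: ip_self_eq_0 words_def)
      then show "feature k y is = feature k (\<lambda>_. 0) is" by (simp only: feature_def)
    qed auto
    then have "gsup ?I {y. ip A y y = 0} (feature k) g = (SUP y\<in>{y. ip A y y = 0}. ip ?I (feature k (\<lambda>_. 0)) g)"
      unfolding gsup_def by (intro SUP_cong) auto
    also have "\<dots> = ip ?I (feature k (\<lambda>_. 0)) g"
      by (rule cSUP_const) (auto intro!: exI[of _ "\<lambda>_. 0"] simp: ip_def)
    finally show "gsup ?I {y. ip A y y = 0} (feature k) g = ip ?I (feature k (\<lambda>_. 0)) g" .
  qed
  then have "sphere_width k A 0 = (\<integral>g. (\<Sum>i\<in>?I. feature k (\<lambda>_. 0) i * g i) \<partial>std_gaussian ?I)"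
    by (simp add: sphere_width_def gwidth_def ip_def)
  also have "\<dots> = (\<Sum>i\<in>?I. \<integral>g. feature k (\<lambda>_. 0) i * g i \<partial>std_gaussian ?I)"
    using std_gaussian_component(1)[of _ ?I "\<lambda>x. x"] integrable_std_normal_power[of 1]
    by (intro Bochner_Integration.integral_sum integrable_mult_right) simp
  also have "\<dots> = 0"
    using std_gaussian_component(2)[of _ ?I "\<lambda>x. x"] integral_std_normal_distribution_moment_odd[of 1]
    by (intro sum.neutral) auto
  finally show ?thesis by simp
qed

lemma sphere_width_step:
  fixes k :: "real poly" and A :: "'a::countable set"
  assumes A: "finite A" "A \<noteq> {}" "a \<notin> A" and k: "nonneg_coeffs k" and d: "0 \<le> d" "d \<le> r"
  shows "sqrt (d * coeff k 1) * (sqrt (card (insert a A)) - 1 / sqrt (card (insert a A)))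
      + sphere_width (descend d k) A (r - d) \<le> sphere_width k (insert a A) r"
proof -
  define A' where "A' = insert a A"
  have A': "finite A'" "a \<in> A'" using A by (auto simp: A'_def)
  define Q where "Q = {..Suc (degree k)} - {1}"
  define I where "I = words A' {1}"
  define J where "J = words A' Q"
  have fin: "finite I" "finite J" "finite Q"
    using A' by (auto simp: I_def J_def Q_def intro!: finite_words)
  have IJ: "I \<inter> J = {}" "words A' {..Suc (degree k)} = I \<union> J"
    by (auto simp: I_def J_def Q_def words_def)
  have \<open>{..Suc (degree k)} = insert 1 Q\<close> "1 \<notin> Q" by (auto simp: Q_def)
  define S where "S = {y. ip A' y y = r}"
  define S' where "S' = {y. ip A y y = r - d}"
  let ?t = "feature k"
  define c where "c = coeff k 1"
  have c: "0 \<le> c" using k by (simp add: c_def nonneg_coeffs_def)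
  have S: "S \<noteq> {}" unfolding S_def using A' d by (intro nonempty_sphere) auto
  have S': "S' \<noteq> {}" unfolding S'_def using A d by (intro nonempty_sphere) auto
  have B: "ip (I \<union> J) (?t s) (?t s) \<le> poly k r" if "s \<in> S" for s
    using that ip_feature_poly[OF A'(1) k, of s s] by (simp add: IJ(2)[symmetric] S_def)
  have gram_J: "ip J (?t y) (?t z) = poly k (ip A' y z) - c * ip A' y z" for y z
    using ip_feature[OF A'(1) fin(3) k, of y z] ip_feature[OF A'(1) _ k, of "{..Suc (degree k)}" y z]
      ip_feature_poly[OF A'(1) k, of y z] \<open>{..Suc (degree k)} = insert 1 Q\<close> \<open>1 \<notin> Q\<close> fin(3)
    by (simp add: J_def c_def)
  have ip_merge: "ip (I \<union> J) x (merge I J (g, h)) = ip I x g + ip J x h" for x g h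
  proof -
    have "ip (I \<union> J) x (merge I J (g, h)) = ip I x (merge I J (g, h)) + ip J x (merge I J (g, h))"
      unfolding ip_def by (rule sum.union_disjoint) (use fin IJ in auto)
    also have "ip I x (merge I J (g, h)) = ip I x g" by (rule ip_cong) (auto simp: merge_def)
    also have "ip J x (merge I J (g, h)) = ip J x h" by (rule ip_cong) (use IJ in \<open>auto simp: merge_def\<close>)
    finally show ?thesis .
  qed
  have inj: "inj_on (\<lambda>i. [i]) A'" by (auto simp: inj_on_def)
  have ip_I: "ip I (?t y) g = sqrt c * ip A' y (\<lambda>i. g [i])" for y g
    unfolding I_def words_singleton_1 ip_def sum.reindex[OF inj]
    by (simp add: feature_def c_def sum_distrib_left mult.assoc)
  have ip_I_self: "ip A' (\<lambda>i. g [i]) (\<lambda>i. g [i]) = ip I g g" for g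
    unfolding I_def words_singleton_1 ip_def sum.reindex[OF inj] by simp
  let ?F = "\<lambda>g h. gsup (I \<union> J) S ?t (merge I J (g, h))"
  let ?W = "sphere_width (descend d k) A (r - d)"
  interpret PI: prob_space "std_gaussian I" by (rule prob_space_std_gaussian)
  interpret PJ: prob_space "std_gaussian J" by (rule prob_space_std_gaussian)
  interpret P: pair_prob_space "std_gaussian I" "std_gaussian J" ..
  have int: "integrable (std_gaussian (I \<union> J)) (gsup (I \<union> J) S ?t)"
    by (rule integrable_gsup[OF _ S B]) (use fin in auto)
  have int_pair: "integrable (std_gaussian I \<Otimes>\<^sub>M std_gaussian J) (\<lambda>(g, h). ?F g h)"
  proof -
    have "integrable (distr (std_gaussian I \<Otimes>\<^sub>M std_gaussian J) (std_gaussian (I \<union> J)) (merge I J)) (gsup (I \<union> J) S ?t)"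
      using int by (simp add: normal_product.distr_merge[OF IJ(1) fin(1,2)])
    from integrable_distr[OF measurable_merge this] show ?thesis by (simp add: case_prod_beta')
  qed
  \<comment> \<open>Fubini provides integrability of the inner supremum only for almost every
    \<open>g\<close>, which is why it appears as a premise here.\<close>
  have inner: "sqrt (d * c) * sqrt (ip I g g) + ?W \<le> (\<integral>h. ?F g h \<partial>std_gaussian J)"
    if int_g: "integrable (std_gaussian J) (?F g)" for g
  proof -
    obtain R where R: "\<And>x y. ip A' (R x) (R y) = ip A' x y"
      "\<And>y. ip A' (R y) (\<lambda>i. g [i]) = y a * sqrt (ip I g g)"
      using exists_isometry_to_axis[OF A', of "\<lambda>i. g [i]"] unfolding ip_I_self by metis
    \<comment> \<open>A point of the smaller sphere receives \<open>sqrt d\<close> in coordinate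
      \<open>a\<close> and is then rotated so that this axis points along \<open>g\<close>.\<close>
    define \<phi> where "\<phi> = (\<lambda>y. R (y(a := sqrt d)))"
    have ip_\<phi>: "ip A' (\<phi> y) (\<phi> z) = d + ip A y z" for y z
    proof -
      have "ip A (y(a := sqrt d)) (z(a := sqrt d)) = ip A y z" by (rule ip_cong) (use A in auto)
      moreover have "ip A' (y(a := sqrt d)) (z(a := sqrt d)) = d + ip A (y(a := sqrt d)) (z(a := sqrt d))"
        using A d by (simp add: A'_def ip_def)
      ultimately show ?thesis by (simp only: \<phi>_def R)
    qed
    have \<phi>S: "\<phi> y \<in> S" if "y \<in> S'" for y
      using that by (simp add: S_def S'_def ip_\<phi>)
    have BJ: "ip J (?t (\<phi> y)) (?t (\<phi> y)) \<le> poly k r - c * r" if "y \<in> S'" for y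
      using \<phi>S[OF that] by (simp add: gram_J S_def)
    have le: "sqrt (d * c) * sqrt (ip I g g) + gsup J S' (\<lambda>y. ?t (\<phi> y)) h \<le> ?F g h" for h
    proof -
      have "ip J (?t (\<phi> y)) h \<le> ?F g h - sqrt (d * c) * sqrt (ip I g g)" if "y \<in> S'" for y
      proof -
        have "ip I (?t (\<phi> y)) g = sqrt (d * c) * sqrt (ip I g g)"
          by (simp add: ip_I \<phi>_def R(2) real_sqrt_mult)
        moreover have "ip (I \<union> J) (?t (\<phi> y)) (merge I J (g, h)) \<le> ?F g h"
          by (rule ip_le_gsup[OF B \<phi>S[OF that]])
        ultimately show ?thesis by (simp add: ip_merge)
      qed
      then have "gsup J S' (\<lambda>y. ?t (\<phi> y)) h \<le> ?F g h - sqrt (d * c) * sqrt (ip I g g)"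
        unfolding gsup_def[of J] by (intro cSUP_least S')
      then show ?thesis by simp
    qed
    have intJ: "integrable (std_gaussian J) (gsup J S' (\<lambda>y. ?t (\<phi> y)))"
      by (rule integrable_gsup[OF fin(2) S' BJ])
    \<comment> \<open>Both processes have covariance \<open>poly k (d + x) - c * (d + x)\<close> at
      inner product \<open>x\<close>; \<open>descend\<close> is defined to match the Gram matrix on
      \<open>J\<close> along \<open>\<phi>\<close>.\<close>
    have "?W = gwidth J S' (\<lambda>y. ?t (\<phi> y))"
      unfolding sphere_width_def S'_def[symmetric]
    proof (rule gwidth_gram_cong[OF finite_words fin(2) S'])
      have gram: "ip (words A {..Suc (degree (descend d k))}) (feature (descend d k) y) (feature (descend d k) z) =
          poly k (d + ip A y z) - c * (d + ip A y z)" for y z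
        using ip_feature_poly[OF A(1) nonneg_coeffs_descend[OF k d(1)], of y z]
        by (simp add: poly_descend c_def)
      then show "ip (words A {..Suc (degree (descend d k))}) (feature (descend d k) y) (feature (descend d k) z) =
          ip J (?t (\<phi> y)) (?t (\<phi> z))" for y z
        by (simp add: gram_J ip_\<phi>)
      show "ip (words A {..Suc (degree (descend d k))}) (feature (descend d k) y) (feature (descend d k) y) \<le> poly k r - c * r"
        if "y \<in> S'" for y
        using that by (simp add: gram S'_def)
    qed (use A in auto)
    then have "sqrt (d * c) * sqrt (ip I g g) + ?W =
        (\<integral>h. sqrt (d * c) * sqrt (ip I g g) + gsup J S' (\<lambda>y. ?t (\<phi> y)) h \<partial>std_gaussian J)"
      by (subst Bochner_Integration.integral_add) (use intJ PJ.prob_space in \<open>auto simp: gwidth_def\<close>)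
    also have "\<dots> \<le> (\<integral>h. ?F g h \<partial>std_gaussian J)"
      by (rule integral_mono[OF Bochner_Integration.integrable_add[OF _ intJ] int_g le]) simp
    finally show ?thesis .
  qed
  have "card I = card A'"
    unfolding I_def words_singleton_1 by (rule card_image[OF inj])
  moreover have "I \<noteq> {}" unfolding I_def words_singleton_1 using A'(2) by auto
  ultimately have norm: "sqrt (card A') - 1 / sqrt (card A') \<le> (\<integral>g. sqrt (ip I g g) \<partial>std_gaussian I)"
    using integral_norm_gaussian_ge[OF fin(1)] by simp
  have "sqrt (d * c) * (sqrt (card A') - 1 / sqrt (card A')) + ?W \<le>
      sqrt (d * c) * (\<integral>g. sqrt (ip I g g) \<partial>std_gaussian I) + ?W"
    using norm c d by (intro add_right_mono mult_left_mono) auto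
  also have "\<dots> = (\<integral>g. sqrt (d * c) * sqrt (ip I g g) + ?W \<partial>std_gaussian I)"
    by (subst Bochner_Integration.integral_add) (use integrable_sqrt_ip[of I] PI.prob_space in auto)
  also have "\<dots> \<le> (\<integral>g. \<integral>h. ?F g h \<partial>std_gaussian J \<partial>std_gaussian I)"
  proof (rule integral_mono_AE)
    show "integrable (std_gaussian I) (\<lambda>g. sqrt (d * c) * sqrt (ip I g g) + ?W)"
      using integrable_sqrt_ip[of I] by simp
    show "integrable (std_gaussian I) (\<lambda>g. \<integral>h. ?F g h \<partial>std_gaussian J)"
      using P.integrable_fst'[OF int_pair] by simp
    show "AE g in std_gaussian I. sqrt (d * c) * sqrt (ip I g g) + ?W \<le> (\<integral>h. ?F g h \<partial>std_gaussian J)"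
      using P.AE_integrable_fst'[OF int_pair] inner by (auto elim: eventually_mono)
  qed
  also have "\<dots> = (\<integral>g. gsup (I \<union> J) S ?t g \<partial>std_gaussian (I \<union> J))"
    by (rule normal_product.product_integral_fold[OF IJ(1) fin(1,2) int, symmetric])
  also have "\<dots> = sphere_width k A' r"
    by (simp add: sphere_width_def gwidth_def IJ(2) S_def)
  finally show ?thesis by (simp add: A'_def c_def)
qed

text \<open>The coefficient of degree one after \<open>j\<close> applications of \<open>descend d\<close>.\<close>

primrec descend_slope :: "real \<Rightarrow> real poly \<Rightarrow> nat \<Rightarrow> real" where
  "descend_slope d k 0 = poly (pderiv k) 0"
| "descend_slope d k (Suc j) = poly (pderiv k) (d * real (Suc j)) - poly (pderiv k) (d * real j)"

lemma coeff_1_eq_pderiv: "coeff k 1 = poly (pderiv k) 0" for k :: "real poly"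
  by (simp add: poly_0_coeff_0 coeff_pderiv)

text \<open>The derivative of the descended polynomial is that of \<open>k\<close> shifted by
  \<open>d\<close>, minus a constant. The constant cancels in every later difference, so only the
  first slope needs the separate clause.\<close>

lemma descend_slope_descend: "descend_slope d (descend d k) j = descend_slope d k (Suc j)"
  by (cases j) (simp_all only: descend_slope.simps poly_pderiv_descend coeff_1_eq_pderiv, simp_all add: algebra_simps)

text \<open>Each step uses up one coordinate and an amount \<open>d\<close> of the squared radius,
  which reaches zero after \<open>m\<close> steps. At least \<open>n\<close> coordinates are always
  left and \<open>s - 1 / s\<close> increases with \<open>s\<close>, so the same factor bounds the
  gain of every step.\<close>

lemma sphere_width_ge_sum:
  fixes A :: "'a::countable set"
  assumes "finite A" "nonneg_coeffs k" "0 \<le> d" "card A = m + n" "0 < n"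
  shows "(sqrt n - 1 / sqrt n) * (\<Sum>j<m. sqrt (d * descend_slope d k j)) \<le> sphere_width k A (m * d)"
  using assms
proof (induction m arbitrary: A k)
  case 0
  then show ?case using sphere_width_zero_nonneg[of A k] by simp
next
  case (Suc m)
  then have "A \<noteq> {}" by auto
  then obtain a where a: "a \<in> A" by auto
  define A0 where "A0 = A - {a}"
  have A0: "A = insert a A0" "a \<notin> A0" "finite A0" "card A0 = m + n"
    using a Suc.prems by (auto simp: A0_def)
  have "A0 \<noteq> {}" using A0 Suc.prems by auto
  have slope: "0 \<le> descend_slope d k 0"
    using Suc.prems by (simp add: coeff_1_eq_pderiv[symmetric] nonneg_coeffs_def)
  have mono: "sqrt n - 1 / sqrt n \<le> sqrt (card A) - 1 / sqrt (card A)"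
    using Suc.prems by (intro diff_mono real_sqrt_le_mono divide_left_mono) auto
  have "(sqrt n - 1 / sqrt n) * (\<Sum>j<Suc m. sqrt (d * descend_slope d k j)) =
      (sqrt n - 1 / sqrt n) * sqrt (d * descend_slope d k 0) +
      (sqrt n - 1 / sqrt n) * (\<Sum>j<m. sqrt (d * descend_slope d (descend d k) j))"
    unfolding sum.lessThan_Suc_shift descend_slope_descend distrib_left ..
  also have "\<dots> \<le> sqrt (d * coeff k 1) * (sqrt (card A) - 1 / sqrt (card A)) + sphere_width (descend d k) A0 (m * d)"
  proof (rule add_mono)
    show "(sqrt n - 1 / sqrt n) * sqrt (d * descend_slope d k 0) \<le> sqrt (d * coeff k 1) * (sqrt (card A) - 1 / sqrt (card A))"
      using mult_left_mono[OF mono, of "sqrt (d * descend_slope d k 0)"] slope Suc.prems(3)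
      by (simp only: coeff_1_eq_pderiv descend_slope.simps mult.commute[of "sqrt (d * _)"]) simp
    show "(sqrt n - 1 / sqrt n) * (\<Sum>j<m. sqrt (d * descend_slope d (descend d k) j)) \<le> sphere_width (descend d k) A0 (m * d)"
      by (rule Suc.IH) (use A0 Suc.prems nonneg_coeffs_descend in auto)
  qed
  also have "\<dots> \<le> sphere_width k A (Suc m * d)"
    using sphere_width_step[OF A0(3) \<open>A0 \<noteq> {}\<close> A0(2), of k d "Suc m * d"] Suc.prems A0(1)
    by (simp add: algebra_simps)
  finally show ?case .
qed

section \<open>Slopes bounded below by the second derivative\<close>

lemma nonneg_coeffs_pderiv: "nonneg_coeffs k \<Longrightarrow> nonneg_coeffs (pderiv k)"
  by (simp add: nonneg_coeffs_def coeff_pderiv)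

lemma poly_mono_nonneg_coeffs:
  assumes "nonneg_coeffs k" "0 \<le> x" "x \<le> y"
  shows "poly k x \<le> poly k y"
  unfolding poly_altdef
  using assms by (intro sum_mono mult_left_mono power_mono) (auto simp: nonneg_coeffs_def)

lemma pderiv_increment_ge:
  assumes "nonneg_coeffs k" "0 \<le> x" "0 \<le> d"
  shows "d * poly (pderiv k) x \<le> poly k (x + d) - poly k x"
proof (cases "d = 0")
  case False
  then have "x < x + d" using assms by simp
  from poly_MVT[OF this, of k] obtain z where z: "x < z" "poly k (x + d) - poly k x = d * poly (pderiv k) z" by auto
  then show ?thesis
    using poly_mono_nonneg_coeffs[OF nonneg_coeffs_pderiv[OF assms(1)] assms(2), of z] assms(3)
    by (simp add: mult_left_mono)
qed simp

text \<open>The gain of the first step is dropped, hence \<open>Suc m\<close> steps for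
  \<open>m\<close> terms. In the later ones convexity of the derivative bounds the slope below by
  \<open>d\<close> times the second derivative, and the square root turns the two factors
  \<open>d\<close> into one.\<close>

lemma sphere_width_ge_riemann_sum:
  fixes A :: "'a::countable set" and d :: real
  assumes "finite A" "nonneg_coeffs k" "0 \<le> d" "card A = Suc m + n" "0 < n"
  shows "(sqrt n - 1 / sqrt n) * (\<Sum>j<m. d * sqrt (poly (pderiv (pderiv k)) (d * real j))) \<le> sphere_width k A (Suc m * d)"
proof -
  have slope0: "0 \<le> descend_slope d k 0"
    using assms by (simp add: coeff_1_eq_pderiv[symmetric] nonneg_coeffs_def)
  have n: "0 \<le> sqrt n - 1 / sqrt n"
    using assms by (simp add: field_simps)
  have "d * sqrt (poly (pderiv (pderiv k)) (d * real j)) \<le> sqrt (d * descend_slope d k (Suc j))" for j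
  proof -
    have "d * poly (pderiv (pderiv k)) (d * real j) \<le> descend_slope d k (Suc j)"
      using pderiv_increment_ge[OF nonneg_coeffs_pderiv[OF assms(2)], of "d * real j" d] assms(3)
      by (simp add: algebra_simps)
    then have "d * (d * poly (pderiv (pderiv k)) (d * real j)) \<le> d * descend_slope d k (Suc j)"
      using assms(3) by (rule mult_left_mono)
    then have "sqrt (d * (d * poly (pderiv (pderiv k)) (d * real j))) \<le> sqrt (d * descend_slope d k (Suc j))"
      by (rule real_sqrt_le_mono)
    then show ?thesis using assms(3) by (simp add: real_sqrt_mult flip: mult.assoc)
  qed
  then have "(\<Sum>j<m. d * sqrt (poly (pderiv (pderiv k)) (d * real j))) \<le> (\<Sum>j<m. sqrt (d * descend_slope d k (Suc j)))"
    by (rule sum_mono)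
  also have "\<dots> \<le> (\<Sum>j<Suc m. sqrt (d * descend_slope d k j))"
    using slope0 assms(3) unfolding sum.lessThan_Suc_shift by simp
  finally have "(sqrt n - 1 / sqrt n) * (\<Sum>j<m. d * sqrt (poly (pderiv (pderiv k)) (d * real j))) \<le>
      (sqrt n - 1 / sqrt n) * (\<Sum>j<Suc m. sqrt (d * descend_slope d k j))"
    using n by (rule mult_left_mono)
  also have "\<dots> \<le> sphere_width k A (Suc m * d)" by (rule sphere_width_ge_sum[OF assms])
  finally show ?thesis .
qed

section \<open>Uniform bounds for the terms of the Hamiltonian\<close>

lemma
  fixes I :: "'i set"
  assumes "finite I"
  shows integrable_ip_square: "integrable (std_gaussian I) (\<lambda>g. (ip I x g)\<^sup>2)"
    and integral_ip_square: "(\<integral>g. (ip I x g)\<^sup>2 \<partial>std_gaussian I) = ip I x x"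
proof -
  define h where "h = (\<lambda>(i::'i) (j::'i) (k::'i) x. (if k = i then x else 1) * (if k = j then x else (1::real)))"
  interpret N: prob_space std_normal_distribution by (rule prob_space_normal_density) simp
  have h_eq: "h i j k = (if k = i then if k = j then \<lambda>x. x ^ 2 else (\<lambda>x. x) else if k = j then \<lambda>x. x else (\<lambda>x. 1))" for i j k
    by (auto simp: h_def fun_eq_iff power2_eq_square)
  have hi: "integrable std_normal_distribution (h i j k)" for i j k
    unfolding h_eq using integrable_std_normal_power[of 1] integrable_std_normal_power[of 2] by auto
  have hv: "(\<integral>x. h i j k x \<partial>std_normal_distribution) = (if k = i then if i = j then 1 else 0 else if k = j then 0 else 1)" for i j k
    unfolding h_eq using std_normal_distribution_even_moments(1)[of 1] integral_std_normal_distribution_moment_odd[of 1]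
      N.prob_space by (auto simp: fact_numeral)
  have prod: "(\<Prod>k\<in>I. h i j k (g k)) = g i * g j" if "i \<in> I" "j \<in> I" for i j g
    using that assms by (simp add: h_def prod.distrib)
  have int: "integrable (std_gaussian I) (\<lambda>g. g i * g j)" if "i \<in> I" "j \<in> I" for i j
    unfolding prod[OF that, symmetric] by (rule normal_product.product_integrable_prod[OF assms hi])
  have val: "(\<integral>g. g i * g j \<partial>std_gaussian I) = (if i = j then 1 else 0)" if "i \<in> I" "j \<in> I" for i j
  proof (cases "i = j")
    case True
    then show ?thesis
      unfolding prod[OF that, symmetric] normal_product.product_integral_prod[OF assms hi] hv
      by (auto intro!: prod.neutral)
  next
    case False
    then show ?thesis
      unfolding prod[OF that, symmetric] normal_product.product_integral_prod[OF assms hi] hv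
      using assms that by (auto intro!: prod_zero bexI[of _ i])
  qed
  have sq: "(ip I x g)\<^sup>2 = (\<Sum>i\<in>I. \<Sum>j\<in>I. (x i * x j) * (g i * g j))" for g
    unfolding ip_def power2_eq_square sum_product by (simp add: mult_ac)
  show "integrable (std_gaussian I) (\<lambda>g. (ip I x g)\<^sup>2)"
    unfolding sq by (intro Bochner_Integration.integrable_sum integrable_mult_right int)
  have "(\<integral>g. (ip I x g)\<^sup>2 \<partial>std_gaussian I) = (\<Sum>i\<in>I. \<integral>g. (\<Sum>j\<in>I. (x i * x j) * (g i * g j)) \<partial>std_gaussian I)"
    unfolding sq by (rule Bochner_Integration.integral_sum) (intro Bochner_Integration.integrable_sum integrable_mult_right int)
  also have "\<dots> = (\<Sum>i\<in>I. \<Sum>j\<in>I. \<integral>g. (x i * x j) * (g i * g j) \<partial>std_gaussian I)"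
    by (intro sum.cong refl Bochner_Integration.integral_sum integrable_mult_right int)
  also have "\<dots> = (\<Sum>i\<in>I. \<Sum>j\<in>I. (x i * x j) * (if i = j then 1 else 0))"
    by (intro sum.cong refl) (simp add: val)
  also have "\<dots> = ip I x x"
    using assms by (simp add: ip_def if_distrib[where f="\<lambda>x. _ * x"] cong: if_cong)
  finally show "(\<integral>g. (ip I x g)\<^sup>2 \<partial>std_gaussian I) = ip I x x" .
qed

definition perm_class :: "'a set \<Rightarrow> nat \<Rightarrow> 'a multiset \<Rightarrow> 'a list set" where
  "perm_class A p m = {is \<in> words A {p}. mset is = m}"

text \<open>The entries of \<open>g\<close> at words that are permutations of each other multiply the same monomial. Summing
  them first gives a bound for the \<open>p\<close>-spin term on the sphere whose expectation is polynomial in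
  \<open>p\<close> for fixed dimension, whereas the Euclidean norm of \<open>g\<close> grows exponentially in \<open>p\<close>.\<close>

definition envelope_sq :: "'a set \<Rightarrow> nat \<Rightarrow> ('a list \<Rightarrow> real) \<Rightarrow> real" where
  "envelope_sq A p g = (\<Sum>m\<in>mset ` words A {p}. (\<Sum>is\<in>perm_class A p m. g is)\<^sup>2 / card (perm_class A p m))"

lemma envelope_sq_nonneg: "0 \<le> envelope_sq A p g"
  by (simp add: envelope_sq_def sum_nonneg)

text \<open>Cauchy-Schwarz is applied over multisets instead of words, after grouping the words with
  equal monomials.\<close>

lemma abs_sum_words_le_envelope:
  fixes \<sigma> :: "'a \<Rightarrow> real"
  assumes "finite A"
  shows "\<bar>\<Sum>is\<in>words A {p}. g is * prod_list (map \<sigma> is)\<bar> \<le> sqrt (envelope_sq A p g) * sqrt (ip A \<sigma> \<sigma>) ^ p"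
proof -
  let ?W = "words A {p}" and ?C = "perm_class A p"
  define S where "S = (\<lambda>m. \<Sum>is\<in>?C m. g is)"
  define \<pi> where "\<pi> = (\<lambda>m. prod_mset (image_mset \<sigma> m))"
  have fin: "finite ?W" "finite (?C m)" for m
    using assms finite_words[of A "{p}"] by (auto simp: perm_class_def)
  have pos: "0 < real (card (?C m))" if "m \<in> mset ` ?W" for m
    using that fin(2)[of m] by (auto simp: card_gt_0_iff perm_class_def)
  have \<pi>: "prod_list (map \<sigma> is) = \<pi> m" if "is \<in> ?C m" for "is" m
    using that by (auto simp: \<pi>_def perm_class_def prod_mset_prod_list[symmetric])
  have "(\<Sum>is\<in>?W. g is * prod_list (map \<sigma> is)) = (\<Sum>m\<in>mset ` ?W. \<Sum>is\<in>?C m. g is * prod_list (map \<sigma> is))"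
    unfolding perm_class_def by (rule sum.image_gen[OF fin(1)])
  also have "\<dots> = (\<Sum>m\<in>mset ` ?W. S m * \<pi> m)"
    by (intro sum.cong refl) (simp add: S_def sum_distrib_right \<pi>)
  \<comment> \<open>The weight \<open>sqrt (card (?C m))\<close> makes the second factor count each
    monomial once per word, so that its square sums back to a power of
    \<open>ip A \<sigma> \<sigma>\<close>.\<close>
  also have "\<dots> = (\<Sum>m\<in>mset ` ?W. (S m / sqrt (card (?C m))) * (sqrt (card (?C m)) * \<pi> m))"
    by (intro sum.cong refl) (use pos in force)
  also have "\<dots> = ip (mset ` ?W) (\<lambda>m. S m / sqrt (card (?C m))) (\<lambda>m. sqrt (card (?C m)) * \<pi> m)"
    by (simp add: ip_def)
  finally have "\<bar>\<Sum>is\<in>?W. g is * prod_list (map \<sigma> is)\<bar> \<le>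
      sqrt (ip (mset ` ?W) (\<lambda>m. S m / sqrt (card (?C m))) (\<lambda>m. S m / sqrt (card (?C m)))) *
      sqrt (ip (mset ` ?W) (\<lambda>m. sqrt (card (?C m)) * \<pi> m) (\<lambda>m. sqrt (card (?C m)) * \<pi> m))"
    using ip_Cauchy_Schwarz by simp
  also have "ip (mset ` ?W) (\<lambda>m. S m / sqrt (card (?C m))) (\<lambda>m. S m / sqrt (card (?C m))) = envelope_sq A p g"
    by (simp add: ip_def envelope_sq_def S_def power2_eq_square)
  also have "ip (mset ` ?W) (\<lambda>m. sqrt (card (?C m)) * \<pi> m) (\<lambda>m. sqrt (card (?C m)) * \<pi> m) = ip A \<sigma> \<sigma> ^ p"
  proof -
    have "ip (mset ` ?W) (\<lambda>m. sqrt (card (?C m)) * \<pi> m) (\<lambda>m. sqrt (card (?C m)) * \<pi> m) =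
        (\<Sum>m\<in>mset ` ?W. \<Sum>is\<in>?C m. prod_list (map (\<lambda>i. \<sigma> i * \<sigma> i) is))"
      unfolding ip_def by (intro sum.cong refl) (simp add: \<pi> flip: prod_list_map_mult)
    also have "\<dots> = (\<Sum>is\<in>?W. prod_list (map (\<lambda>i. \<sigma> i * \<sigma> i) is))"
      unfolding perm_class_def by (rule sum.image_gen[OF fin(1), symmetric])
    also have "\<dots> = ip A \<sigma> \<sigma> ^ p"
      unfolding words_def ip_def using sum_prod_list_words[OF assms] by simp
    finally show ?thesis .
  qed
  finally show ?thesis by (simp add: real_sqrt_power)
qed

text \<open>A multiset of size \<open>p\<close> over \<open>A\<close> is determined by its
  multiplicities, each at most \<open>p\<close>. The count is crude, but polynomial in
  \<open>p\<close> for fixed \<open>A\<close>.\<close>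

lemma card_mset_words_le:
  assumes "finite A"
  shows "card (mset ` words A {p}) \<le> Suc p ^ card A"
proof -
  have "inj_on (\<lambda>m. restrict (count m) A) (mset ` words A {p})"
  proof (rule inj_onI)
    fix m m' assume m: "m \<in> mset ` words A {p}" "m' \<in> mset ` words A {p}"
      and eq: "restrict (count m) A = restrict (count m') A"
    show "m = m'"
    proof (rule multiset_eqI)
      fix x
      show "count m x = count m' x"
      proof (cases "x \<in> A")
        case True
        then show ?thesis using fun_cong[OF eq, of x] by simp
      next
        case False
        then have "x \<notin># m" "x \<notin># m'" using m by (auto simp: words_def)
        then show ?thesis by (simp add: not_in_iff)
      qed
    qed
  qed
  moreover have "(\<lambda>m. restrict (count m) A) ` mset ` words A {p} \<subseteq> A \<rightarrow>\<^sub>E {..p}"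
    using count_le_size by (force simp: words_def size_mset[symmetric] simp del: size_mset)
  moreover have "finite (A \<rightarrow>\<^sub>E {..p})" using assms by (intro finite_PiE) auto
  ultimately have "card (mset ` words A {p}) \<le> card (A \<rightarrow>\<^sub>E {..p})" by (rule card_inj_on_le)
  then show ?thesis using assms by (simp add: card_PiE)
qed

text \<open>The sum over a class has second moment equal to the size of the class. After
  normalization every class contributes at most 1, so the expectation is bounded by the number of
  multisets.\<close>

lemma
  assumes "finite A"
  shows integrable_envelope_sq: "integrable (std_gaussian (words A {p})) (envelope_sq A p)"
    and integral_envelope_sq: "(\<integral>g. envelope_sq A p g \<partial>std_gaussian (words A {p})) \<le> real (Suc p ^ card A)"
proof -
  let ?W = "words A {p}" and ?C = "perm_class A p"
  let ?x = "\<lambda>m is. of_bool (is \<in> ?C m) :: real"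
  have fin: "finite ?W" using assms by (intro finite_words) auto
  have C: "?C m \<subseteq> ?W" for m by (auto simp: perm_class_def)
  have S: "(\<Sum>is\<in>?C m. g is) = ip ?W (?x m) g" for m g
    unfolding ip_def by (rule sum.mono_neutral_cong_left) (use fin C in auto)
  have self: "ip ?W (?x m) (?x m) = card (?C m)" for m
    using S[where m=m and g="?x m"] by simp
  have eq: "envelope_sq A p = (\<lambda>g. \<Sum>m\<in>mset ` ?W. (ip ?W (?x m) g)\<^sup>2 / card (?C m))"
    by (simp add: envelope_sq_def[abs_def] S)
  show "integrable (std_gaussian ?W) (envelope_sq A p)"
    unfolding eq by (intro Bochner_Integration.integrable_sum integrable_divide integrable_ip_square fin)
  have "(\<integral>g. envelope_sq A p g \<partial>std_gaussian ?W) = (\<Sum>m\<in>mset ` ?W. \<integral>g. (ip ?W (?x m) g)\<^sup>2 / card (?C m) \<partial>std_gaussian ?W)"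
    unfolding eq by (intro Bochner_Integration.integral_sum integrable_divide integrable_ip_square fin)
  also have "\<dots> = (\<Sum>m\<in>mset ` ?W. real (card (?C m)) / card (?C m))"
    by (simp add: integral_ip_square[OF fin] self)
  also have "\<dots> \<le> (\<Sum>m\<in>mset ` ?W. 1)"
    by (intro sum_mono) simp
  also have "\<dots> \<le> real (Suc p ^ card A)"
    using card_mset_words_le[OF assms, of p] by (simp only: sum_constant mult_1_right of_nat_1 of_nat_le_iff)
  finally show "(\<integral>g. envelope_sq A p g \<partial>std_gaussian ?W) \<le> real (Suc p ^ card A)" .
qed

section \<open>Joint law of the disorder\<close>

definition disorder_on :: "'w measure \<Rightarrow> (nat list \<Rightarrow> 'w \<Rightarrow> real) \<Rightarrow> nat list set \<Rightarrow> 'w \<Rightarrow> nat list \<Rightarrow> real" where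
  "disorder_on M J I \<omega> = (\<lambda>i\<in>I. J i \<omega>)"

lemma
  assumes G: "gaussian_disorder M J" and I: "I \<noteq> {}" "I \<subseteq> {is. 2 \<le> length is \<and> set is \<subseteq> {1..}}"
  shows disorder_on_measurable: "disorder_on M J I \<in> M \<rightarrow>\<^sub>M std_gaussian I"
    and distr_disorder_on: "distr M (std_gaussian I) (disorder_on M J I) = std_gaussian I"
proof -
  interpret prob_space M using G by (simp add: gaussian_disorder_def)
  have D: "distributed M lborel (J i) std_normal_density" if "i \<in> I" for i
    using G I that by (auto simp: gaussian_disorder_def)
  have rv: "J i \<in> borel_measurable M" if "i \<in> I" for i
    using distributed_measurable[OF D[OF that]] by simp
  have dist: "distr M borel (J i) = std_normal_distribution" if "i \<in> I" for i
    using distributed_distr_eq_density[OF D[OF that]] by (simp cong: distr_cong)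
  have S: "sets (PiM I (\<lambda>_. borel)) = sets (std_gaussian I)"
    by (rule sets_PiM_cong) auto
  show m: "disorder_on M J I \<in> M \<rightarrow>\<^sub>M std_gaussian I"
    unfolding disorder_on_def[abs_def] by (rule measurable_restrict) (simp add: rv)
  have "indep_vars (\<lambda>_. borel) J I"
    using G I(2) by (auto simp: gaussian_disorder_def intro: indep_vars_subset)
  then have "distr M (PiM I (\<lambda>_. borel)) (\<lambda>\<omega>. \<lambda>i\<in>I. J i \<omega>) = PiM I (\<lambda>i. distr M borel (J i))"
    using indep_vars_iff_distr_eq_PiM'[OF I(1), where M'="\<lambda>_. borel" and X=J] rv by simp
  also have "\<dots> = std_gaussian I" by (rule PiM_cong) (auto simp: dist)
  finally show "distr M (std_gaussian I) (disorder_on M J I) = std_gaussian I"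
    by (simp add: disorder_on_def[abs_def] S cong: distr_cong)
qed

section \<open>Truncated Hamiltonians\<close>

definition scaled_coeff :: "(nat \<Rightarrow> real) \<Rightarrow> nat \<Rightarrow> nat \<Rightarrow> real" where
  "scaled_coeff \<gamma> N p = \<gamma> p / real N powr ((real p - 1) / 2)"

definition energy_trunc :: "(nat \<Rightarrow> real) \<Rightarrow> nat \<Rightarrow> (nat list \<Rightarrow> real) \<Rightarrow> nat \<Rightarrow> (nat \<Rightarrow> real) \<Rightarrow> real" where
  "energy_trunc \<gamma> P g N \<sigma> = (\<Sum>k<P. scaled_coeff \<gamma> N (k + 2) * p_spin g (k + 2) N \<sigma>)"

definition mixture_poly :: "(nat \<Rightarrow> real) \<Rightarrow> nat \<Rightarrow> real poly" where
  "mixture_poly \<gamma> P = (\<Sum>k<P. monom ((\<gamma> (k + 2))\<^sup>2) (k + 2))"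

lemma nonneg_coeffs_mixture_poly: "nonneg_coeffs (mixture_poly \<gamma> P)"
  by (auto simp: nonneg_coeffs_def mixture_poly_def coeff_sum intro!: sum_nonneg)

lemma poly_mixture_poly: "poly (mixture_poly \<gamma> P) x = (\<Sum>k<P. (\<gamma> (k + 2))\<^sup>2 * x ^ (k + 2))"
  by (simp add: mixture_poly_def poly_sum poly_monom)

lemma poly_pderiv2_mixture_poly:
  "poly (pderiv (pderiv (mixture_poly \<gamma> P))) x = (\<Sum>k<P. real ((k + 2) * (k + 1)) * (\<gamma> (k + 2))\<^sup>2 * x ^ k)"
proof -
  have "pderiv (pderiv (mixture_poly \<gamma> P)) = (\<Sum>k<P. pderiv (pderiv (monom ((\<gamma> (k + 2))\<^sup>2) (k + 2))))"
    using higher_pderiv_sum[of 2 "\<lambda>k. monom ((\<gamma> (k + 2))\<^sup>2) (k + 2)" "{..<P}"]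
    by (simp add: mixture_poly_def numeral_2_eq_2)
  then show ?thesis
    by (simp add: poly_sum pderiv_monom poly_monom algebra_simps)
qed

lemma words_spin: "{is. length is = p \<and> set is \<subseteq> A} = words A {p}"
  by (auto simp: words_def)

lemma energy_trunc_as_ip:
  "energy_trunc \<gamma> P g N \<sigma> =
    ip (words {1..N} {2..<P + 2}) (\<lambda>is. scaled_coeff \<gamma> N (length is) * prod_list (map \<sigma> is)) g"
proof -
  have "ip (words {1..N} {2..<P + 2}) (\<lambda>is. scaled_coeff \<gamma> N (length is) * prod_list (map \<sigma> is)) g =
    (\<Sum>p\<in>{0 + 2..<P + 2}. \<Sum>is\<in>words {1..N} {p}. scaled_coeff \<gamma> N (length is) * prod_list (map \<sigma> is) * g is)"
    unfolding ip_def add_0 by (subst sum_words) (auto simp: words_def simp del: sum.op_ivl_Suc)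
  also have "\<dots> = (\<Sum>p\<in>{0 + 2..<P + 2}. scaled_coeff \<gamma> N p * p_spin g p N \<sigma>)"
    unfolding p_spin_def words_spin
    by (intro sum.cong refl) (auto simp: words_def sum_distrib_left intro!: sum.cong)
  finally show ?thesis
    unfolding sum.shift_bounds_nat_ivl energy_trunc_def lessThan_atLeast0 by simp
qed

lemma powr_half_pred: "0 < N \<Longrightarrow> 0 < p \<Longrightarrow> real N powr ((real p - 1) / 2) = sqrt (real N) ^ (p - 1)"
  by (simp add: powr_half_sqrt[symmetric] powr_power of_nat_diff)

text \<open>Of the \<open>p\<close> factors \<open>N\<close> in the power, the normalization cancels
  all but one. This is why the covariance at inner product \<open>N * x\<close> is \<open>N\<close>
  times the mixture at \<open>x\<close>.\<close>

lemma scaled_coeff_square: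
  assumes "0 < N" "0 < p"
  shows "scaled_coeff \<gamma> N p * scaled_coeff \<gamma> N p * (real N * x) ^ p = real N * ((\<gamma> p)\<^sup>2 * x ^ p)"
proof -
  have "scaled_coeff \<gamma> N p * scaled_coeff \<gamma> N p = (\<gamma> p)\<^sup>2 / real N ^ (p - 1)"
    using assms by (simp add: scaled_coeff_def powr_half_pred power2_eq_square flip: power_mult_distrib)
  moreover have "(real N * x) ^ p = real N ^ (p - 1) * (real N * x ^ p)"
    using assms by (cases p) (auto simp: power_mult_distrib)
  ultimately show ?thesis using assms by simp
qed

lemma ip_sphere_N: "\<sigma> \<in> sphere_N N (sqrt r) \<Longrightarrow> 0 \<le> r \<Longrightarrow> ip {1..N} \<sigma> \<sigma> = r"
  by (auto simp: sphere_N_def L2_set_def ip_def power2_eq_square sum_nonneg)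

lemma rescale_in_sphere_N:
  fixes q :: real
  assumes "ip {1..N} y y = q"
  shows "(\<lambda>i\<in>{1..N}. sqrt N * y i) \<in> sphere_N N (sqrt (N * q))"
proof -
  have "(\<Sum>i\<in>{1..N}. ((\<lambda>i\<in>{1..N}. sqrt N * y i) i)\<^sup>2) = (\<Sum>i\<in>{1..N}. N * (y i * y i))"
    by (rule sum.cong[OF refl]) (simp add: power_mult_distrib power2_eq_square)
  also have "\<dots> = N * q" using assms by (simp add: ip_def flip: sum_distrib_left)
  finally show ?thesis by (simp only: sphere_N_def L2_set_def) auto
qed

lemma sphere_N_nonempty:
  fixes q :: real
  assumes "0 < N" "0 \<le> q"
  shows "sphere_N N (sqrt (N * q)) \<noteq> {}"
proof -
  obtain y where "ip {1..N} y y = q"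
    using nonempty_sphere[of "{1..N}" q] assms by auto
  from rescale_in_sphere_N[OF this] show ?thesis by blast
qed

text \<open>The sign that turns the minimum into a supremum cancels in the Gram matrix. Rescaling by
  \<open>sqrt N\<close> makes the covariance \<open>N\<close> times the truncated mixture, and the
  scalar \<open>N\<close> leaves the square roots as \<open>sqrt N\<close>. Coordinates outside
  \<open>{1..N}\<close> are free in \<open>?Y\<close> but fixed in \<open>sphere_N\<close>, so the
  two spheres are related by the map \<open>?\<phi>\<close>.\<close>

lemma gwidth_energy_ge:
  fixes N m n P :: nat and q d :: real
  assumes N: "N = Suc m + n" "0 < n" and q: "0 \<le> q" and d: "d = q / Suc m"
  shows "(sqrt n - 1 / sqrt n) * sqrt N * (\<Sum>j<m. d * sqrt (poly (pderiv (pderiv (mixture_poly \<gamma> P))) (d * real j)))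
    \<le> gwidth (words {1..N} {2..<P + 2}) (sphere_N N (sqrt (N * q)))
        (\<lambda>\<sigma> is. - scaled_coeff \<gamma> N (length is) * prod_list (map \<sigma> is))"
proof -
  let ?A = "{1..N}"
  let ?I = "words ?A {2..<P + 2}"
  let ?S = "sphere_N N (sqrt (N * q))"
  let ?t = "\<lambda>\<sigma> is. - scaled_coeff \<gamma> N (length is) * prod_list (map \<sigma> is)"
  let ?k = "smult (real N) (mixture_poly \<gamma> P)"
  let ?\<phi> = "\<lambda>y. \<lambda>i\<in>?A. sqrt N * y i"
  let ?Y = "{y. ip ?A y y = q}"
  have N0: "0 < N" using N by simp
  have I: "finite ?I" by (intro finite_words) auto
  have gram: "ip ?I (?t \<sigma>) (?t \<tau>) = (\<Sum>p\<in>{2..<P + 2}. scaled_coeff \<gamma> N p * scaled_coeff \<gamma> N p * ip ?A \<sigma> \<tau> ^ p)" for \<sigma> \<tau>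
    using ip_words[of ?A "{2..<P + 2}" "\<lambda>p. - scaled_coeff \<gamma> N p" \<sigma> "\<lambda>p. - scaled_coeff \<gamma> N p" \<tau>] by simp
  have ip\<phi>: "ip ?A (?\<phi> y) (?\<phi> z) = N * ip ?A y z" for y z
  proof -
    have "ip ?A (?\<phi> y) (?\<phi> z) = (\<Sum>i\<in>?A. (sqrt N * sqrt N) * (y i * z i))"
      unfolding ip_def by (rule sum.cong[OF refl]) (simp only: restrict_apply' mult_ac)
    then show ?thesis by (simp add: ip_def sum_distrib_left)
  qed
  have gram\<phi>: "ip ?I (?t (?\<phi> y)) (?t (?\<phi> z)) = poly ?k (ip ?A y z)" for y z
  proof -
    have "ip ?I (?t (?\<phi> y)) (?t (?\<phi> z)) = (\<Sum>p\<in>{0 + 2..<P + 2}. real N * ((\<gamma> p)\<^sup>2 * ip ?A y z ^ p))"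
      unfolding gram ip\<phi> using N0 by (intro sum.cong) (auto simp: scaled_coeff_square)
    also have "\<dots> = real N * (\<Sum>k<P. (\<gamma> (k + 2))\<^sup>2 * ip ?A y z ^ (k + 2))"
      unfolding sum.shift_bounds_nat_ivl lessThan_atLeast0 by (simp add: sum_distrib_left)
    also have "\<dots> = poly ?k (ip ?A y z)" by (simp add: poly_mixture_poly)
    finally show ?thesis .
  qed
  have Y: "?Y \<noteq> {}" using N0 q by (intro nonempty_sphere) auto
  define B where "B = (\<Sum>p\<in>{2..<P + 2}. scaled_coeff \<gamma> N p * scaled_coeff \<gamma> N p * (N * q) ^ p)"
  have B: "ip ?I (?t \<sigma>) (?t \<sigma>) \<le> B" if "\<sigma> \<in> ?S" for \<sigma>
    unfolding gram B_def using ip_sphere_N[OF that] q by simp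
  have \<phi>S: "?\<phi> y \<in> ?S" if "y \<in> ?Y" for y using rescale_in_sphere_N that by blast
  have k: "nonneg_coeffs ?k" using nonneg_coeffs_mixture_poly[of \<gamma> P] by (simp add: nonneg_coeffs_def)
  have "(sqrt n - 1 / sqrt n) * sqrt N * (\<Sum>j<m. d * sqrt (poly (pderiv (pderiv (mixture_poly \<gamma> P))) (d * real j))) =
      (sqrt n - 1 / sqrt n) * (\<Sum>j<m. d * sqrt (poly (pderiv (pderiv ?k)) (d * real j)))"
    by (simp add: pderiv_smult real_sqrt_mult sum_distrib_left mult_ac)
  also have "\<dots> \<le> sphere_width ?k ?A (Suc m * d)"
    by (rule sphere_width_ge_riemann_sum) (use N q d k in auto)
  also have "Suc m * d = q" by (simp add: d)
  also have "sphere_width ?k ?A q = gwidth ?I ?Y (\<lambda>y. ?t (?\<phi> y))"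
    unfolding sphere_width_def
  proof (rule gwidth_gram_cong[OF _ I Y])
    show "ip (words ?A {..Suc (degree ?k)}) (feature ?k y) (feature ?k z) = ip ?I (?t (?\<phi> y)) (?t (?\<phi> z))" for y z
      unfolding gram\<phi> by (rule ip_feature_poly) (use k in auto)
    show "ip (words ?A {..Suc (degree ?k)}) (feature ?k y) (feature ?k y) \<le> poly ?k q" if "y \<in> ?Y" for y
      using that ip_feature_poly[of ?A ?k y y] k by simp
  qed (intro finite_words; simp)
  also have "\<dots> \<le> gwidth ?I ?S ?t"
    unfolding gwidth_def
  proof (rule integral_mono)
    show "integrable (std_gaussian ?I) (gsup ?I ?S ?t)"
      by (rule integrable_gsup[OF I _ B]) (use sphere_N_nonempty[OF N0 q] in auto)
    show "integrable (std_gaussian ?I) (gsup ?I ?Y (\<lambda>y. ?t (?\<phi> y)))"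
      by (rule integrable_gsup[OF I Y B[OF \<phi>S]])
    show "gsup ?I ?Y (\<lambda>y. ?t (?\<phi> y)) g \<le> gsup ?I ?S ?t g" for g
      unfolding gsup_def[of ?I ?Y] by (intro cSUP_least[OF Y] ip_le_gsup[OF B \<phi>S])
  qed
  finally show ?thesis .
qed

lemma
  fixes \<gamma> :: "nat \<Rightarrow> real" and N m n P :: nat and q d :: real
  assumes G: "gaussian_disorder M J"
    and N: "N = Suc m + n" "0 < n" and P: "0 < P" and q: "0 \<le> q" and d: "d = q / Suc m"
  defines "X \<equiv> \<lambda>\<omega>. INF \<sigma>\<in>sphere_N N (sqrt (N * q)). energy_trunc \<gamma> P (\<lambda>is. J is \<omega>) N \<sigma>"
  shows min_energy_trunc_measurable: "X \<in> borel_measurable M"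
    and integral_min_energy_trunc_le: "(\<integral>\<omega>. X \<omega> \<partial>M) \<le>
      - ((sqrt n - 1 / sqrt n) * sqrt N * (\<Sum>j<m. d * sqrt (poly (pderiv (pderiv (mixture_poly \<gamma> P))) (d * real j))))"
proof -
  let ?I = "words {1..N} {2..<P + 2}"
  let ?S = "sphere_N N (sqrt (N * q))"
  let ?t = "\<lambda>\<sigma> is. - scaled_coeff \<gamma> N (length is) * prod_list (map \<sigma> is)"
  have N0: "0 < N" using N by simp
  have I: "finite ?I" by (intro finite_words) auto
  \<comment> \<open>A positive \<open>P\<close> ensures that degree two is present, so the index set
    is nonempty, as the law of the disorder requires. For the same reason truncations are later
    taken at \<open>Suc P\<close>.\<close>
  have "replicate 2 1 \<in> ?I" using P N0 by (auto simp: words_def)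
  then have I0: "?I \<noteq> {}" by blast
  have Isub: "?I \<subseteq> {is. 2 \<le> length is \<and> set is \<subseteq> {1..}}" by (auto simp: words_def)
  have S: "?S \<noteq> {}" by (rule sphere_N_nonempty[OF N0 q])
  have gram: "ip ?I (?t \<sigma>) (?t \<tau>) = (\<Sum>p\<in>{2..<P + 2}. scaled_coeff \<gamma> N p * scaled_coeff \<gamma> N p * ip {1..N} \<sigma> \<tau> ^ p)" for \<sigma> \<tau>
    using ip_words[of "{1..N}" "{2..<P + 2}" "\<lambda>p. - scaled_coeff \<gamma> N p" \<sigma> "\<lambda>p. - scaled_coeff \<gamma> N p" \<tau>] by simp
  define B where "B = (\<Sum>p\<in>{2..<P + 2}. scaled_coeff \<gamma> N p * scaled_coeff \<gamma> N p * (N * q) ^ p)"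
  have B: "ip ?I (?t \<sigma>) (?t \<sigma>) \<le> B" if "\<sigma> \<in> ?S" for \<sigma>
    unfolding gram B_def using ip_sphere_N[OF that] q by simp
  have X: "X = (\<lambda>\<omega>. - gsup ?I ?S ?t (disorder_on M J ?I \<omega>))"
  proof
    fix \<omega>
    have "- energy_trunc \<gamma> P (\<lambda>is. J is \<omega>) N \<sigma> = ip ?I (?t \<sigma>) (disorder_on M J ?I \<omega>)" for \<sigma>
      unfolding energy_trunc_as_ip ip_def sum_negf[symmetric]
      by (rule sum.cong[OF refl]) (simp add: disorder_on_def)
    then show "X \<omega> = - gsup ?I ?S ?t (disorder_on M J ?I \<omega>)"
      by (simp add: X_def gsup_def Inf_real_def image_image)
  qed
  have gm: "gsup ?I ?S ?t \<in> borel_measurable (std_gaussian ?I)"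
    by (rule gsup_measurable[OF I S B])
  have m: "disorder_on M J ?I \<in> M \<rightarrow>\<^sub>M std_gaussian ?I"
    by (rule disorder_on_measurable[OF G I0 Isub])
  show "X \<in> borel_measurable M"
    unfolding X using measurable_compose[OF m gm] by simp
  have "(\<integral>\<omega>. gsup ?I ?S ?t (disorder_on M J ?I \<omega>) \<partial>M) = gwidth ?I ?S ?t"
    using integral_distr[OF m gm, symmetric] unfolding distr_disorder_on[OF G I0 Isub] gwidth_def .
  then show "(\<integral>\<omega>. X \<omega> \<partial>M) \<le>
      - ((sqrt n - 1 / sqrt n) * sqrt N * (\<Sum>j<m. d * sqrt (poly (pderiv (pderiv (mixture_poly \<gamma> P))) (d * real j))))"
    using gwidth_energy_ge[OF N q d, of \<gamma> P] by (simp add: X)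
qed

section \<open>Removal of the truncation\<close>

lemma abs_cINF_diff_le:
  fixes f g :: "'a \<Rightarrow> real"
  assumes "S \<noteq> {}" "bdd_below (f ` S)" "bdd_below (g ` S)" and le: "\<And>s. s \<in> S \<Longrightarrow> \<bar>f s - g s\<bar> \<le> e"
  shows "\<bar>(INF s\<in>S. f s) - (INF s\<in>S. g s)\<bar> \<le> e"
proof -
  have "(INF s\<in>S. f s) - e \<le> g s" if "s \<in> S" for s
    using cINF_lower[OF assms(2) that] le[OF that] by linarith
  then have "(INF s\<in>S. f s) - e \<le> (INF s\<in>S. g s)" by (intro cINF_greatest assms(1))
  moreover have "(INF s\<in>S. g s) - e \<le> f s" if "s \<in> S" for s
    using cINF_lower[OF assms(3) that] le[OF that] by linarith
  then have "(INF s\<in>S. g s) - e \<le> (INF s\<in>S. f s)" by (intro cINF_greatest assms(1))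
  ultimately show ?thesis by linarith
qed

lemma AE_summable_nonneg:
  fixes f :: "nat \<Rightarrow> 'a \<Rightarrow> real"
  assumes f: "\<And>k. integrable M (f k)" "\<And>k x. 0 \<le> f k x" and s: "summable (\<lambda>k. \<integral>x. f k x \<partial>M)"
  shows "AE x in M. summable (\<lambda>k. f k x)"
proof -
  have m: "f k \<in> borel_measurable M" for k using f(1) by auto
  have "(\<integral>\<^sup>+x. (\<Sum>k. ennreal (f k x)) \<partial>M) = (\<Sum>k. \<integral>\<^sup>+x. ennreal (f k x) \<partial>M)"
    by (rule nn_integral_suminf) (use m in measurable)
  also have "\<dots> = (\<Sum>k. ennreal (\<integral>x. f k x \<partial>M))"
    by (simp add: nn_integral_eq_integral f)
  also have "\<dots> \<noteq> \<infinity>"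
    using s f(2) by (simp add: suminf_ennreal2)
  finally have "AE x in M. (\<Sum>k. ennreal (f k x)) \<noteq> \<infinity>"
    by (intro nn_integral_PInf_AE) (use m in measurable)
  then show ?thesis
    using f(2) by (auto elim!: eventually_mono intro!: summable_suminf_not_top)
qed

text \<open>The infimum of the full Hamiltonian is known only to agree almost surely with a limit of
  measurable functions, so it is measurable for the completion.\<close>

lemma borel_measurable_completion_AE_eq:
  fixes f g :: "'a \<Rightarrow> real"
  assumes g: "g \<in> borel_measurable M" and ae: "AE x in M. f x = g x"
  shows "f \<in> borel_measurable (completion M)"
proof (rule measurableI)
  fix A :: "real set" assume A: "A \<in> sets borel"
  show "f -` A \<inter> space (completion M) \<in> sets (completion M)"
  proof (rule completion.in_sets_AE)
    show "AE x in completion M. (x \<in> g -` A \<inter> space M) = (x \<in> f -` A \<inter> space (completion M))"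
      using AE_completion[OF ae] by (auto elim: eventually_mono)
    show "g -` A \<inter> space M \<in> sets (completion M)"
      using measurable_sets[OF g A] by simp
  qed auto
qed auto

text \<open>Summability of the dominating terms: the coefficients decay geometrically, while the
  expected envelope grows only polynomially in the degree.\<close>

lemma summable_geometric_times_polynomial:
  fixes r :: real
  assumes "0 < r" "r < 1"
  shows "summable (\<lambda>k. r ^ k * (1 + real (k + 3) ^ N))"
proof -
  \<comment> \<open>Any number strictly between \<open>r\<close> and 1 would serve as the ratio,
    since the quotient of consecutive terms tends to \<open>r\<close>.\<close>
  define c where "c = (1 + r) / 2"
  have c: "r < c" "c < 1" using assms by (auto simp: c_def)
  have "((\<lambda>k. real (k + 4) / real (k + 3)) \<longlonglongrightarrow> 1)" by real_asymp
  then have "(\<lambda>k. r * (real (k + 4) / real (k + 3)) ^ N) \<longlonglongrightarrow> r * 1 ^ N"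
    by (intro tendsto_intros)
  then have ev: "eventually (\<lambda>k. r * (real (k + 4) / real (k + 3)) ^ N < c) sequentially"
    using c by (auto dest: order_tendstoD(2))
  then obtain K where K: "\<And>k. k \<ge> K \<Longrightarrow> r * (real (k + 4) / real (k + 3)) ^ N < c"
    by (auto simp: eventually_sequentially)
  have "summable (\<lambda>k. r ^ k * real (k + 3) ^ N)"
  proof (rule summable_ratio_test[OF c(2)])
    fix k assume k: "K \<le> k"
    have "r ^ Suc k * real (Suc k + 3) ^ N = (r * (real (k + 4) / real (k + 3)) ^ N) * (r ^ k * real (k + 3) ^ N)"
      by (simp add: power_divide add.commute)
    also have "\<dots> \<le> c * (r ^ k * real (k + 3) ^ N)"
      using K[OF k] assms by (intro mult_right_mono) auto
    finally show "norm (r ^ Suc k * real (Suc k + 3) ^ N) \<le> c * norm (r ^ k * real (k + 3) ^ N)"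
      using assms by simp
  qed
  then have "summable (\<lambda>k. r ^ k + r ^ k * real (k + 3) ^ N)"
    using assms by (intro summable_add summable_geometric) auto
  then show ?thesis by (simp add: distrib_left)
qed

text \<open>On the sphere the powers of \<open>N\<close> cancel up to one factor
  \<open>sqrt N\<close>, and powers of \<open>sqrt q\<close> are at most 1. For fixed
  \<open>N\<close> the exponential decay of \<open>\<gamma>\<close> therefore survives.\<close>

lemma scaled_coeff_sphere:
  fixes q :: real
  assumes "is_mixture \<gamma>" "0 < N" "0 \<le> q" "q \<le> 1"
  shows "\<exists>C r. 0 < r \<and> r < 1 \<and> 0 \<le> C \<and> (\<forall>k. 0 \<le> scaled_coeff \<gamma> N (k + 2) * sqrt (N * q) ^ (k + 2) \<and>
    scaled_coeff \<gamma> N (k + 2) * sqrt (N * q) ^ (k + 2) \<le> C * r ^ k)"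
proof -
  obtain C r where r: "0 < r" "r < 1" and C: "\<And>p. 2 \<le> p \<Longrightarrow> \<gamma> p \<le> C * r ^ p" and \<gamma>: "\<And>p. 2 \<le> p \<Longrightarrow> 0 \<le> \<gamma> p"
    using assms(1) by (auto simp: is_mixture_def)
  have eq: "scaled_coeff \<gamma> N (k + 2) * sqrt (N * q) ^ (k + 2) = sqrt N * (\<gamma> (k + 2) * sqrt q ^ (k + 2))" for k
    using assms(2) powr_half_pred[of N "k + 2"]
    by (simp add: scaled_coeff_def real_sqrt_mult power_mult_distrib)
  \<comment> \<open>The sign of the constant is not part of the decay condition; it follows from
    \<open>\<gamma> 2\<close> lying between 0 and this bound.\<close>
  have "0 \<le> C * r ^ 2" using C[of 2] \<gamma>[of 2] by linarith
  show ?thesis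
  proof (rule exI[of _ "sqrt N * (C * r ^ 2)"], rule exI[of _ r], intro conjI allI)
    show "0 \<le> scaled_coeff \<gamma> N (k + 2) * sqrt (N * q) ^ (k + 2)" for k
      unfolding eq using \<gamma> assms by simp
    show "scaled_coeff \<gamma> N (k + 2) * sqrt (N * q) ^ (k + 2) \<le> sqrt N * (C * r ^ 2) * r ^ k" for k
    proof -
      have "\<gamma> (k + 2) * sqrt q ^ (k + 2) \<le> \<gamma> (k + 2) * 1"
        using \<gamma>[of "k + 2"] assms by (intro mult_left_mono power_le_one) auto
      also have "\<dots> \<le> C * r ^ (k + 2)" using C[of "k + 2"] by simp
      finally have "sqrt N * (\<gamma> (k + 2) * sqrt q ^ (k + 2)) \<le> sqrt N * (C * r ^ (k + 2))"
        by (intro mult_left_mono) auto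
      then show ?thesis unfolding eq by (simp add: power_add power2_eq_square mult_ac)
    qed
    show "0 \<le> sqrt N * (C * r ^ 2)" using \<open>0 \<le> C * r ^ 2\<close> by simp
  qed (use r in auto)
qed

lemma hamiltonian_suminf: "hamiltonian \<gamma> g N \<sigma> = (\<Sum>k. scaled_coeff \<gamma> N (k + 2) * p_spin g (k + 2) N \<sigma>)"
  by (simp add: hamiltonian_def scaled_coeff_def Let_def)

text \<open>Dominated convergence: \<open>w k\<close> bounds the term of degree \<open>k + 2\<close>
  uniformly on the sphere, and the sum of all \<open>w k\<close> is integrable. The tails then
  control the infima uniformly.\<close>

lemma min_energy_limit:
  fixes \<gamma> :: "nat \<Rightarrow> real" and q :: real
  assumes mix: "is_mixture \<gamma>" and G: "gaussian_disorder M J" and N: "0 < N" and q: "0 \<le> q" "q \<le> 1"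
  defines "X \<equiv> \<lambda>P \<omega>. INF \<sigma>\<in>sphere_N N (sqrt (N * q)). energy_trunc \<gamma> P (\<lambda>is. J is \<omega>) N \<sigma>"
  assumes meas: "\<And>P. X (Suc P) \<in> borel_measurable M"
  shows "(\<lambda>P. \<integral>\<omega>. X (Suc P) \<omega> \<partial>M) \<longlonglongrightarrow>
    (\<integral>\<omega>. (INF \<sigma>\<in>sphere_N N (sqrt (N * q)). hamiltonian \<gamma> (\<lambda>is. J is \<omega>) N \<sigma>) \<partial>completion M)"
proof -
  interpret prob_space M using G by (simp add: gaussian_disorder_def)
  let ?A = "{1..N}" and ?S = "sphere_N N (sqrt (N * q))"
  have S: "?S \<noteq> {}" by (rule sphere_N_nonempty[OF N q(1)])
  define a where "a = (\<lambda>k. scaled_coeff \<gamma> N (k + 2) * sqrt (N * q) ^ (k + 2))"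
  obtain C r where r: "0 < r" "r < 1" "0 \<le> C" and a0: "\<And>k. 0 \<le> a k" and aC: "\<And>k. a k \<le> C * r ^ k"
    using scaled_coeff_sphere[OF mix N q] unfolding a_def by blast
  \<comment> \<open>The envelope enters under a square root, which is at most 1 plus its argument.
    Thus the first moment of \<open>envelope_sq\<close> suffices.\<close>
  define w where "w = (\<lambda>k \<omega>. a k * (1 + envelope_sq ?A (k + 2) (disorder_on M J (words ?A {k + 2}) \<omega>)))"
  have w0: "0 \<le> w k \<omega>" for k \<omega>
    unfolding w_def using a0 envelope_sq_nonneg by (intro mult_nonneg_nonneg add_nonneg_nonneg) auto
  have env: "integrable M (\<lambda>\<omega>. envelope_sq ?A (k + 2) (disorder_on M J (words ?A {k + 2}) \<omega>))"
    "(\<integral>\<omega>. envelope_sq ?A (k + 2) (disorder_on M J (words ?A {k + 2}) \<omega>) \<partial>M) \<le> real (k + 3) ^ N" for k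
  proof -
    let ?I = "words ?A {k + 2}"
    have "replicate (k + 2) 1 \<in> ?I" using N by (auto simp: words_def)
    then have I0: "?I \<noteq> {}" by blast
    have I: "?I \<subseteq> {is. 2 \<le> length is \<and> set is \<subseteq> {1..}}" by (auto simp: words_def)
    note m = disorder_on_measurable[OF G I0 I] and D = distr_disorder_on[OF G I0 I]
    have e: "integrable (distr M (std_gaussian ?I) (disorder_on M J ?I)) (envelope_sq ?A (k + 2))"
      unfolding D by (rule integrable_envelope_sq) simp
    show "integrable M (\<lambda>\<omega>. envelope_sq ?A (k + 2) (disorder_on M J ?I \<omega>))"
      by (rule integrable_distr[OF m e])
    have em: "envelope_sq ?A (k + 2) \<in> borel_measurable (std_gaussian ?I)"
      using borel_measurable_integrable[OF e] by simp
    have "(\<integral>\<omega>. envelope_sq ?A (k + 2) (disorder_on M J ?I \<omega>) \<partial>M) = (\<integral>g. envelope_sq ?A (k + 2) g \<partial>std_gaussian ?I)"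
      using integral_distr[OF m em, symmetric] unfolding D .
    also have "\<dots> \<le> real (Suc (k + 2) ^ card ?A)" by (rule integral_envelope_sq) simp
    finally show "(\<integral>\<omega>. envelope_sq ?A (k + 2) (disorder_on M J ?I \<omega>) \<partial>M) \<le> real (k + 3) ^ N"
      by (simp add: numeral_3_eq_3)
  qed
  have wi: "integrable M (w k)" for k
    unfolding w_def by (intro integrable_mult_right Bochner_Integration.integrable_add env) simp
  have wb: "(\<integral>\<omega>. w k \<omega> \<partial>M) \<le> C * (r ^ k * (1 + real (k + 3) ^ N))" for k
  proof -
    have "(\<integral>\<omega>. w k \<omega> \<partial>M) = a k * (1 + (\<integral>\<omega>. envelope_sq ?A (k + 2) (disorder_on M J (words ?A {k + 2}) \<omega>) \<partial>M))"
      unfolding w_def using env(1)[of k] by (simp add: Bochner_Integration.integral_add prob_space)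
    also have "\<dots> \<le> (C * r ^ k) * (1 + real (k + 3) ^ N)"
    proof (intro mult_mono aC add_left_mono env(2))
      show "0 \<le> C * r ^ k" using r by simp
      show "0 \<le> 1 + (\<integral>\<omega>. envelope_sq ?A (k + 2) (disorder_on M J (words ?A {k + 2}) \<omega>) \<partial>M)"
        by (intro add_nonneg_nonneg Bochner_Integration.integral_nonneg envelope_sq_nonneg) simp
    qed
    finally show ?thesis by (simp add: mult.assoc)
  qed
  have ws: "summable (\<lambda>k. \<integral>\<omega>. w k \<omega> \<partial>M)"
  proof (rule summable_comparison_test')
    show "summable (\<lambda>k. C * (r ^ k * (1 + real (k + 3) ^ N)))"
      by (intro summable_mult summable_geometric_times_polynomial r)
    show "norm (\<integral>\<omega>. w k \<omega> \<partial>M) \<le> C * (r ^ k * (1 + real (k + 3) ^ N))" if "0 \<le> k" for k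
      using wb[of k] w0 by (simp add: integral_nonneg)
  qed
  have ae: "AE \<omega> in M. summable (\<lambda>k. w k \<omega>)"
    by (rule AE_summable_nonneg[OF wi w0 ws])
  have Wi: "integrable M (\<lambda>\<omega>. \<Sum>k. w k \<omega>)"
    by (rule integrable_suminf[OF wi]) (use ae w0 ws in auto)
  have term_le: "\<bar>scaled_coeff \<gamma> N (k + 2) * p_spin (\<lambda>is. J is \<omega>) (k + 2) N \<sigma>\<bar> \<le> w k \<omega>" if "\<sigma> \<in> ?S" for k \<sigma> \<omega>
  proof -
    let ?g = "disorder_on M J (words ?A {k + 2}) \<omega>"
    have c: "0 \<le> scaled_coeff \<gamma> N (k + 2)"
      using mix by (simp add: scaled_coeff_def is_mixture_def)
    have sqrt_le: "sqrt x \<le> 1 + x" if "0 \<le> x" for x :: real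
      using that by (intro real_le_lsqrt) (auto simp: power2_eq_square algebra_simps)
    have "p_spin (\<lambda>is. J is \<omega>) (k + 2) N \<sigma> = (\<Sum>is\<in>words ?A {k + 2}. ?g is * prod_list (map \<sigma> is))"
      unfolding p_spin_def words_spin by (rule sum.cong[OF refl]) (simp add: disorder_on_def)
    then have "\<bar>p_spin (\<lambda>is. J is \<omega>) (k + 2) N \<sigma>\<bar> \<le> sqrt (envelope_sq ?A (k + 2) ?g) * sqrt (ip ?A \<sigma> \<sigma>) ^ (k + 2)"
      using abs_sum_words_le_envelope[of ?A ?g \<sigma> "k + 2"] by simp
    also have "\<dots> \<le> (1 + envelope_sq ?A (k + 2) ?g) * sqrt (N * q) ^ (k + 2)"
    proof -
      have "ip ?A \<sigma> \<sigma> = N * q" using ip_sphere_N[OF that] q by simp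
      then show ?thesis
        using sqrt_le[OF envelope_sq_nonneg] q by (simp only:) (intro mult_right_mono, auto)
    qed
    finally have "scaled_coeff \<gamma> N (k + 2) * \<bar>p_spin (\<lambda>is. J is \<omega>) (k + 2) N \<sigma>\<bar> \<le>
        scaled_coeff \<gamma> N (k + 2) * ((1 + envelope_sq ?A (k + 2) ?g) * sqrt (N * q) ^ (k + 2))"
      using c by (rule mult_left_mono)
    then show ?thesis using c by (simp add: abs_mult w_def a_def mult_ac)
  qed
  define H where "H = (\<lambda>\<omega>. INF \<sigma>\<in>?S. hamiltonian \<gamma> (\<lambda>is. J is \<omega>) N \<sigma>)"
  have conv: "(\<lambda>P. X (Suc P) \<omega>) \<longlonglongrightarrow> H \<omega> \<and> (\<forall>P. \<bar>X (Suc P) \<omega>\<bar> \<le> (\<Sum>k. w k \<omega>))"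
    if s: "summable (\<lambda>k. w k \<omega>)" for \<omega>
  proof -
    let ?h = "\<lambda>k \<sigma>. scaled_coeff \<gamma> N (k + 2) * p_spin (\<lambda>is. J is \<omega>) (k + 2) N \<sigma>"
    have hs: "summable (\<lambda>k. ?h k \<sigma>)" if "\<sigma> \<in> ?S" for \<sigma>
      by (rule summable_comparison_test'[OF s]) (use term_le that in auto)
    have tr: "\<bar>energy_trunc \<gamma> P (\<lambda>is. J is \<omega>) N \<sigma>\<bar> \<le> (\<Sum>k. w k \<omega>)" if "\<sigma> \<in> ?S" for P \<sigma>
    proof -
      have "\<bar>energy_trunc \<gamma> P (\<lambda>is. J is \<omega>) N \<sigma>\<bar> \<le> (\<Sum>k<P. \<bar>?h k \<sigma>\<bar>)"
        unfolding energy_trunc_def by (rule sum_abs)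
      also have "\<dots> \<le> (\<Sum>k<P. w k \<omega>)" by (intro sum_mono term_le that)
      also have "\<dots> \<le> (\<Sum>k. w k \<omega>)" by (rule sum_le_suminf[OF s]) (auto simp: w0)
      finally show ?thesis .
    qed
    have diff: "\<bar>energy_trunc \<gamma> P (\<lambda>is. J is \<omega>) N \<sigma> - hamiltonian \<gamma> (\<lambda>is. J is \<omega>) N \<sigma>\<bar> \<le> (\<Sum>k. w (k + P) \<omega>)"
      if "\<sigma> \<in> ?S" for P \<sigma>
    proof -
      have "hamiltonian \<gamma> (\<lambda>is. J is \<omega>) N \<sigma> = (\<Sum>k. ?h (k + P) \<sigma>) + energy_trunc \<gamma> P (\<lambda>is. J is \<omega>) N \<sigma>"
        unfolding hamiltonian_suminf energy_trunc_def by (rule suminf_split_initial_segment[OF hs[OF that]])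
      moreover have "\<bar>\<Sum>k. ?h (k + P) \<sigma>\<bar> \<le> (\<Sum>k. w (k + P) \<omega>)"
        by (rule order_trans[OF _ norm_suminf_le[of "\<lambda>k. ?h (k + P) \<sigma>" "\<lambda>k. w (k + P) \<omega>"]])
          (use term_le that summable_ignore_initial_segment[OF s, of P] in auto)
      ultimately show ?thesis by linarith
    qed
    have bddX: "bdd_below ((\<lambda>\<sigma>. energy_trunc \<gamma> P (\<lambda>is. J is \<omega>) N \<sigma>) ` ?S)" for P
    proof (rule bdd_belowI2[where m="- (\<Sum>k. w k \<omega>)"])
      fix \<sigma> assume "\<sigma> \<in> ?S"
      from tr[OF this, of P] show "- (\<Sum>k. w k \<omega>) \<le> energy_trunc \<gamma> P (\<lambda>is. J is \<omega>) N \<sigma>" by linarith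
    qed
    have bddH: "bdd_below ((\<lambda>\<sigma>. hamiltonian \<gamma> (\<lambda>is. J is \<omega>) N \<sigma>) ` ?S)"
    proof (rule bdd_belowI2[where m="- (\<Sum>k. w k \<omega>) - (\<Sum>k. w (k + 0) \<omega>)"])
      fix \<sigma> assume "\<sigma> \<in> ?S"
      from tr[OF this, of 0] diff[OF this, of 0]
      show "- (\<Sum>k. w k \<omega>) - (\<Sum>k. w (k + 0) \<omega>) \<le> hamiltonian \<gamma> (\<lambda>is. J is \<omega>) N \<sigma>" by linarith
    qed
    have XH: "\<bar>X P \<omega> - H \<omega>\<bar> \<le> (\<Sum>k. w (k + P) \<omega>)" for P
      unfolding X_def H_def by (rule abs_cINF_diff_le[OF S bddX bddH diff])
    have "(\<lambda>P. \<Sum>k. w (k + P) \<omega>) \<longlonglongrightarrow> 0" by (rule suminf_exist_split2[OF s])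
    then have "(\<lambda>P. X P \<omega> - H \<omega>) \<longlonglongrightarrow> 0"
      by (rule Lim_null_comparison[rotated]) (use XH in auto)
    then have "(\<lambda>P. X P \<omega>) \<longlonglongrightarrow> H \<omega>" by (simp add: LIM_zero_iff)
    then have "(\<lambda>P. X (Suc P) \<omega>) \<longlonglongrightarrow> H \<omega>" by (rule LIMSEQ_Suc)
    moreover have "\<bar>X P \<omega>\<bar> \<le> (\<Sum>k. w k \<omega>)" for P
    proof -
      obtain \<sigma> where \<sigma>: "\<sigma> \<in> ?S" using S by auto
      have "X P \<omega> \<le> energy_trunc \<gamma> P (\<lambda>is. J is \<omega>) N \<sigma>"
        unfolding X_def by (rule cINF_lower[OF bddX \<sigma>])
      moreover have "- (\<Sum>k. w k \<omega>) \<le> X P \<omega>"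
        unfolding X_def
      proof (rule cINF_greatest[OF S])
        fix \<sigma> assume "\<sigma> \<in> ?S"
        from tr[OF this, of P] show "- (\<Sum>k. w k \<omega>) \<le> energy_trunc \<gamma> P (\<lambda>is. J is \<omega>) N \<sigma>" by linarith
      qed
      ultimately show ?thesis using tr[OF \<sigma>, of P] by linarith
    qed
    ultimately show ?thesis by blast
  qed
  \<comment> \<open>A version of \<open>H\<close> that is measurable for \<open>M\<close> itself;
    the two may differ where the series of \<open>w\<close> diverges, which is a null set.\<close>
  define Y where "Y = (\<lambda>\<omega>. lim (\<lambda>P. X (Suc P) \<omega>))"
  have Ym: "Y \<in> borel_measurable M"
    unfolding Y_def by (rule borel_measurable_lim_metric[OF meas])
  have lim_eq: "Y \<omega> = H \<omega>" if "summable (\<lambda>k. w k \<omega>)" for \<omega>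
    using conv[OF that] unfolding Y_def by (intro limI) blast
  have HY: "AE \<omega> in M. H \<omega> = Y \<omega>"
    using ae by eventually_elim (simp add: lim_eq)
  have "(\<lambda>P. \<integral>\<omega>. X (Suc P) \<omega> \<partial>M) \<longlonglongrightarrow> (\<integral>\<omega>. Y \<omega> \<partial>M)"
  proof (rule integral_dominated_convergence[OF Ym meas Wi])
    show "AE \<omega> in M. (\<lambda>P. X (Suc P) \<omega>) \<longlonglongrightarrow> Y \<omega>"
      using ae by eventually_elim (use conv lim_eq in auto)
    show "AE \<omega> in M. norm (X (Suc P) \<omega>) \<le> (\<Sum>k. w k \<omega>)" for P
      using ae by eventually_elim (use conv in auto)
  qed
  also have "(\<integral>\<omega>. Y \<omega> \<partial>M) = (\<integral>\<omega>. Y \<omega> \<partial>completion M)"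
    by (rule integral_completion[OF Ym, symmetric])
  also have "\<dots> = (\<integral>\<omega>. H \<omega> \<partial>completion M)"
  proof (rule integral_cong_AE)
    show "AE \<omega> in completion M. Y \<omega> = H \<omega>"
      using AE_completion[OF HY] by (auto elim: eventually_mono)
  qed (use Ym borel_measurable_completion_AE_eq[OF Ym HY] in \<open>auto intro: measurable_completion\<close>)
  finally show ?thesis by (simp add: H_def)
qed

section \<open>The Riemann sum\<close>

definition mixture_second :: "(nat \<Rightarrow> real) \<Rightarrow> real \<Rightarrow> real" where
  "mixture_second \<gamma> x = (\<Sum>k. real ((k + 2) * (k + 1)) * (\<gamma> (k + 2))\<^sup>2 * x ^ k)"

text \<open>Squaring \<open>\<gamma>\<close> gives coefficients of order \<open>r ^ (2 * n)\<close>,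
  so there is room for \<open>\<bar>x\<bar>\<close> up to \<open>1 / r\<close>. A radius beyond 1
  makes the endpoint \<open>x = 1\<close> an interior point.\<close>

lemma mixture_power_series:
  assumes "is_mixture \<gamma>"
  defines "c \<equiv> \<lambda>n. if n < 2 then 0 else (\<gamma> n)\<^sup>2"
  shows "\<exists>K>1. (\<forall>x. \<bar>x\<bar> < K \<longrightarrow> summable (\<lambda>n. c n * x ^ n)) \<and>
    (\<forall>x. \<bar>x\<bar> < K \<longrightarrow> mixture \<gamma> x = (\<Sum>n. c n * x ^ n))"
proof -
  obtain C r where r: "0 < r" "r < 1" and C: "\<And>p. 2 \<le> p \<Longrightarrow> \<gamma> p \<le> C * r ^ p" and \<gamma>: "\<And>p. 2 \<le> p \<Longrightarrow> 0 \<le> \<gamma> p"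
    using assms(1) by (auto simp: is_mixture_def)
  have sm: "summable (\<lambda>n. c n * x ^ n)" if x: "\<bar>x\<bar> < 1 / r" for x
  proof (rule summable_comparison_test')
    show "summable (\<lambda>n. C\<^sup>2 * r ^ n)" using r by (intro summable_mult summable_geometric) auto
    show "norm (c n * x ^ n) \<le> C\<^sup>2 * r ^ n" if "0 \<le> n" for n
    proof (cases "n < 2")
      case False
      then have sq: "(\<gamma> n)\<^sup>2 \<le> (C * r ^ n)\<^sup>2" using C[of n] \<gamma>[of n] by (intro power_mono) auto
      then have "(\<gamma> n)\<^sup>2 * \<bar>x\<bar> ^ n \<le> (C * r ^ n)\<^sup>2 * (1 / r) ^ n"
        using x by (intro mult_mono[OF sq] power_mono) auto
      also have "\<dots> = C\<^sup>2 * r ^ n" using r by (simp add: power2_eq_square power_divide)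
      finally show ?thesis using False by (simp add: c_def abs_mult power_abs)
    qed (use r in \<open>simp add: c_def\<close>)
  qed
  moreover have "mixture \<gamma> x = (\<Sum>n. c n * x ^ n)" if "\<bar>x\<bar> < 1 / r" for x
    using suminf_split_initial_segment[OF sm[OF that], of 2]
    by (simp add: mixture_def c_def numeral_2_eq_2)
  ultimately show ?thesis using r by (intro exI[of _ "1 / r"]) auto
qed

text \<open>Termwise differentiation inside the disc of convergence, which contains
  \<open>x = 1\<close>, so the two-sided \<open>deriv\<close> is meaningful there. The third
  derivative only supplies continuity of the second.\<close>

lemma
  assumes "is_mixture \<gamma>" "\<bar>x\<bar> \<le> 1"
  shows deriv2_mixture: "(deriv ^^ 2) (mixture \<gamma>) x = mixture_second \<gamma> x"
    and summable_mixture_second: "summable (\<lambda>k. real ((k + 2) * (k + 1)) * (\<gamma> (k + 2))\<^sup>2 * x ^ k)"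
    and isCont_mixture_second: "isCont (mixture_second \<gamma>) x"
proof -
  define c where "c = (\<lambda>n. if n < 2 then 0 else (\<gamma> n)\<^sup>2)"
  obtain K where K: "1 < K" and sm: "\<And>x. \<bar>x\<bar> < K \<Longrightarrow> summable (\<lambda>n. c n * x ^ n)"
    and mix: "\<And>x. \<bar>x\<bar> < K \<Longrightarrow> mixture \<gamma> x = (\<Sum>n. c n * x ^ n)"
    using mixture_power_series[OF assms(1)] unfolding c_def by blast
  have d1: "((\<lambda>x. \<Sum>n. c n * x ^ n) has_field_derivative (\<Sum>n. diffs c n * x ^ n)) (at x)" if "\<bar>x\<bar> < K" for x
    by (rule termdiffs_strong'[of K]) (use sm that in auto)
  have sm1: "summable (\<lambda>n. diffs c n * x ^ n)" if "\<bar>x\<bar> < K" for x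
    by (rule termdiff_converges[of _ K]) (use sm that in auto)
  have d2: "((\<lambda>x. \<Sum>n. diffs c n * x ^ n) has_field_derivative (\<Sum>n. diffs (diffs c) n * x ^ n)) (at x)" if "\<bar>x\<bar> < K" for x
    by (rule termdiffs_strong'[of K]) (use sm1 that in auto)
  have sm2: "summable (\<lambda>n. diffs (diffs c) n * x ^ n)" if "\<bar>x\<bar> < K" for x
    by (rule termdiff_converges[of _ K]) (use sm1 that in auto)
  have d3: "((\<lambda>x. \<Sum>n. diffs (diffs c) n * x ^ n) has_field_derivative (\<Sum>n. diffs (diffs (diffs c)) n * x ^ n)) (at x)" if "\<bar>x\<bar> < K" for x
    by (rule termdiffs_strong'[of K]) (use sm2 that in auto)
  have eq: "diffs (diffs c) n = real ((n + 2) * (n + 1)) * (\<gamma> (n + 2))\<^sup>2" for n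
    by (simp add: diffs_def c_def algebra_simps)
  have x: "\<bar>x\<bar> < K" using assms(2) K by simp
  have nhd: "eventually (\<lambda>y. \<bar>y\<bar> < K) (nhds y)" if "\<bar>y\<bar> < K" for y :: real
    using that eventually_nhds_in_open[of "ball 0 K" y] by (auto simp: dist_real_def)
  have D1: "deriv (mixture \<gamma>) y = (\<Sum>n. diffs c n * y ^ n)" if "\<bar>y\<bar> < K" for y
  proof -
    have "deriv (mixture \<gamma>) y = deriv (\<lambda>x. \<Sum>n. c n * x ^ n) y"
      by (rule deriv_cong_ev) (use nhd[OF that] mix in \<open>auto elim: eventually_mono\<close>)
    then show ?thesis using DERIV_imp_deriv[OF d1[OF that]] by simp
  qed
  have "(deriv ^^ 2) (mixture \<gamma>) x = deriv (deriv (mixture \<gamma>)) x" by (simp add: numeral_2_eq_2)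
  also have "\<dots> = deriv (\<lambda>x. \<Sum>n. diffs c n * x ^ n) x"
    by (rule deriv_cong_ev) (use nhd[OF x] D1 in \<open>auto elim: eventually_mono\<close>)
  also have "\<dots> = mixture_second \<gamma> x"
    using DERIV_imp_deriv[OF d2[OF x]] by (simp add: eq mixture_second_def)
  finally show "(deriv ^^ 2) (mixture \<gamma>) x = mixture_second \<gamma> x" .
  show "summable (\<lambda>k. real ((k + 2) * (k + 1)) * (\<gamma> (k + 2))\<^sup>2 * x ^ k)"
    using sm2[OF x] unfolding eq .
  show "isCont (mixture_second \<gamma>) x"
    using DERIV_isCont[OF d3[OF x]] unfolding eq mixture_second_def[abs_def] .
qed

lemma mixture_second_mono:
  assumes "is_mixture \<gamma>" "0 \<le> x" "x \<le> y" "y \<le> 1"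
  shows "mixture_second \<gamma> x \<le> mixture_second \<gamma> y"
  unfolding mixture_second_def
  using assms by (intro suminf_le summable_mixture_second mult_left_mono power_mono) auto

lemma integral_le_riemann_sum:
  fixes f :: "real \<Rightarrow> real"
  assumes "f integrable_on {0..real n * d}" "0 \<le> d"
    and mono: "\<And>x y. 0 \<le> x \<Longrightarrow> x \<le> y \<Longrightarrow> y \<le> real n * d \<Longrightarrow> f x \<le> f y"
  shows "integral {0..real n * d} f \<le> (\<Sum>j<n. d * f (real (Suc j) * d))"
  using assms(1,3)
proof (induction n)
  case (Suc n)
  have le: "real n * d \<le> real (Suc n) * d" "0 \<le> real n * d" using assms(2) by (auto intro: mult_right_mono)
  have int: "f integrable_on {0..real n * d}" "f integrable_on {real n * d..real (Suc n) * d}"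
    by (rule integrable_on_subinterval[OF Suc.prems(1)]; use le in auto)+
  have "integral {real n * d..real (Suc n) * d} f \<le> integral {real n * d..real (Suc n) * d} (\<lambda>_. f (real (Suc n) * d))"
    using Suc.prems(2) le int by (intro integral_le) auto
  also have "\<dots> = d * f (real (Suc n) * d)"
    using le by (simp add: algebra_simps)
  finally have "integral {real n * d..real (Suc n) * d} f \<le> d * f (real (Suc n) * d)" .
  moreover have "integral {0..real n * d} f \<le> (\<Sum>j<n. d * f (real (Suc j) * d))"
    using Suc.IH[OF int(1)] Suc.prems(2) le by force
  moreover have "integral {0..real (Suc n) * d} f = integral {0..real n * d} f + integral {real n * d..real (Suc n) * d} f"
    using Henstock_Kurzweil_Integration.integral_combine[OF le(2,1) Suc.prems(1)] by simp
  ultimately show ?case by simp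
qed simp

section \<open>Growing dimension with a fixed number of steps\<close>

text \<open>The truncation is removed here at fixed dimension. The dimension is
  \<open>n + Suc m\<close> because the \<open>Suc m\<close> steps use up that many coordinates, and
  dividing the factor \<open>sqrt N\<close> by \<open>N\<close> leaves
  \<open>1 / sqrt N\<close>.\<close>

lemma mean_min_energy_le:
  fixes q d :: real
  assumes mix: "is_mixture \<gamma>" and G: "gaussian_disorder M J" and q: "0 \<le> q" "q \<le> 1"
    and d: "d = q / Suc m" and n: "0 < n"
  shows "mean_min_energy M J \<gamma> q (n + Suc m) \<le>
    - ((sqrt n - 1 / sqrt n) / sqrt (n + Suc m) * (\<Sum>j<m. d * sqrt (mixture_second \<gamma> (d * real j))))"
proof -
  define N where "N = n + Suc m"
  have N: "N = Suc m + n" "0 < N" by (auto simp: N_def)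
  define X where "X = (\<lambda>P \<omega>. INF \<sigma>\<in>sphere_N N (sqrt (N * q)). energy_trunc \<gamma> P (\<lambda>is. J is \<omega>) N \<sigma>)"
  define c where "c = (sqrt n - 1 / sqrt n) * sqrt N"
  let ?R = "\<lambda>P. \<Sum>j<m. d * sqrt (poly (pderiv (pderiv (mixture_poly \<gamma> (Suc P)))) (d * real j))"
  let ?R' = "\<Sum>j<m. d * sqrt (mixture_second \<gamma> (d * real j))"
  have meas: "X (Suc P) \<in> borel_measurable M" for P
    unfolding X_def by (rule min_energy_trunc_measurable[OF G N(1) n _ q(1) d]) simp
  have le: "(\<integral>\<omega>. X (Suc P) \<omega> \<partial>M) \<le> - (c * ?R P)" for P
    unfolding X_def c_def by (rule integral_min_energy_trunc_le[OF G N(1) n _ q(1) d]) simp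
  have lim1: "(\<lambda>P. \<integral>\<omega>. X (Suc P) \<omega> \<partial>M) \<longlonglongrightarrow>
    (\<integral>\<omega>. (INF \<sigma>\<in>sphere_N N (sqrt (N * q)). hamiltonian \<gamma> (\<lambda>is. J is \<omega>) N \<sigma>) \<partial>completion M)"
    unfolding X_def by (rule min_energy_limit[OF mix G N(2) q]) (rule meas[unfolded X_def])
  have "(\<lambda>P. poly (pderiv (pderiv (mixture_poly \<gamma> (Suc P)))) (d * real j)) \<longlonglongrightarrow> mixture_second \<gamma> (d * real j)" if "j < m" for j
  proof -
    have "0 \<le> d * real j" using q by (simp add: d)
    moreover have "d * real j \<le> 1"
    proof -
      have "q * real j \<le> 1 * real (Suc m)" using q that by (intro mult_mono) auto
      then show ?thesis by (simp add: d field_simps)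
    qed
    ultimately have "summable (\<lambda>k. real ((k + 2) * (k + 1)) * (\<gamma> (k + 2))\<^sup>2 * (d * real j) ^ k)"
      by (intro summable_mixture_second[OF mix]) auto
    from LIMSEQ_Suc[OF summable_LIMSEQ[OF this]] show ?thesis
      unfolding poly_pderiv2_mixture_poly mixture_second_def .
  qed
  then have lim2: "(\<lambda>P. - (c * ?R P)) \<longlonglongrightarrow> - (c * ?R')"
    by (intro tendsto_intros) auto
  have "(\<integral>\<omega>. (INF \<sigma>\<in>sphere_N N (sqrt (N * q)). hamiltonian \<gamma> (\<lambda>is. J is \<omega>) N \<sigma>) \<partial>completion M) \<le> - (c * ?R')"
    by (rule LIMSEQ_le[OF lim1 lim2]) (use le in auto)
  then have "mean_min_energy M J \<gamma> q N \<le> 1 / N * - (c * ?R')"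
    unfolding mean_min_energy_def by (intro mult_left_mono) auto
  also have "\<dots> = - ((sqrt n - 1 / sqrt n) / sqrt N * ?R')"
  proof -
    have "1 / N * - (c * ?R') = - ((sqrt n - 1 / sqrt n) * ?R' * (sqrt N / N))" by (simp add: c_def)
    also have "sqrt N / N = 1 / sqrt N" using N(2) by (simp add: real_div_sqrt field_simps)
    finally show ?thesis by simp
  qed
  finally show ?thesis by (simp add: N_def)
qed

text \<open>With \<open>m\<close> fixed, the ratio of \<open>sqrt n - 1 / sqrt n\<close> to
  \<open>sqrt (n + Suc m)\<close> tends to 1. Convergence of the mean energies makes
  \<open>lim\<close> a genuine limit, so the inequality passes to it.\<close>

lemma E_star_ge_riemann_sum:
  fixes q d :: real
  assumes "is_mixture \<gamma>" "gaussian_disorder M J" "0 \<le> q" "q \<le> 1" "convergent (mean_min_energy M J \<gamma> q)"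
    and "d = q / Suc m"
  shows "(\<Sum>j<m. d * sqrt (mixture_second \<gamma> (d * real j))) \<le> E_star M J \<gamma> q"
proof -
  let ?R = "\<Sum>j<m. d * sqrt (mixture_second \<gamma> (d * real j))"
  have "mean_min_energy M J \<gamma> q \<longlonglongrightarrow> lim (mean_min_energy M J \<gamma> q)"
    using assms(5) by (simp add: convergent_LIMSEQ_iff)
  then have "(\<lambda>n. mean_min_energy M J \<gamma> q (n + Suc m)) \<longlonglongrightarrow> lim (mean_min_energy M J \<gamma> q)"
    by (rule LIMSEQ_ignore_initial_segment)
  moreover have "(\<lambda>n. (sqrt (real n) - 1 / sqrt (real n)) / sqrt (real n + a)) \<longlonglongrightarrow> 1" for a :: real
    by real_asymp
  from this[of "real (Suc m)"]
  have "(\<lambda>n. - ((sqrt (real n) - 1 / sqrt (real n)) / sqrt (real (n + Suc m)) * ?R)) \<longlonglongrightarrow> - (1 * ?R)"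
    unfolding of_nat_add by (intro tendsto_minus tendsto_mult tendsto_const)
  ultimately have "lim (mean_min_energy M J \<gamma> q) \<le> - (1 * ?R)"
  proof (rule LIMSEQ_le)
    show "\<exists>n0. \<forall>n\<ge>n0. mean_min_energy M J \<gamma> q (n + Suc m) \<le>
        - ((sqrt (real n) - 1 / sqrt (real n)) / sqrt (real (n + Suc m)) * ?R)"
      using mean_min_energy_le[OF assms(1-4,6)] by (intro exI[of _ 1] allI impI) (simp only: One_nat_def Suc_le_eq)
  qed
  then show ?thesis by (simp add: E_star_def)
qed

theorem corollary5:
  fixes M :: "'w measure" and J :: "nat list \<Rightarrow> 'w \<Rightarrow> real"
    and \<gamma> :: "nat \<Rightarrow> real" and q :: real
  assumes "is_mixture \<gamma>"
    and "gaussian_disorder M J"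
    and "q \<in> {0..1}"
    and "convergent (mean_min_energy M J \<gamma> q)"
  shows "E_star M J \<gamma> q \<ge> integral {0..q} (\<lambda>t. sqrt ((deriv ^^ 2) (mixture \<gamma>) t))"
proof -
  define f where "f = (\<lambda>t. sqrt (mixture_second \<gamma> t))"
  have q: "0 \<le> q" "q \<le> 1" using assms(3) by auto
  have mono: "f x \<le> f y" if "0 \<le> x" "x \<le> y" "y \<le> q" for x y
    unfolding f_def using mixture_second_mono[OF assms(1) that(1,2)] that q by simp
  have f0: "0 \<le> f x" if "0 \<le> x" "x \<le> q" for x
  proof -
    have "0 \<le> f 0" by (simp add: f_def mixture_second_def)
    then show ?thesis using mono[of 0 x] that by linarith
  qed
  have "continuous_on {0..q} f"
    unfolding f_def using isCont_mixture_second[OF assms(1)] q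
    by (intro continuous_on_real_sqrt continuous_at_imp_continuous_on) auto
  then have int: "f integrable_on {0..q}" by (rule integrable_continuous_real)
  \<comment> \<open>The integral of a monotone function is bounded above by right endpoints, while
    the estimate for \<open>E_star\<close> offers left endpoints with \<open>j < m\<close>. After
    the nonnegative term \<open>d * f 0\<close> aligns the indices, the top terms
    \<open>j = m\<close> and \<open>j = m + 1\<close> are left over, each at most
    \<open>d * f q\<close>; they account for the error, which vanishes as \<open>m\<close>
    grows.\<close>
  have bound: "integral {0..q} f - 2 * (q / Suc m) * f q \<le> E_star M J \<gamma> q" for m
  proof -
    define d where "d = q / Suc m"
    have d: "0 \<le> d" "real (Suc m) * d = q" using q by (auto simp: d_def)
    have m: "0 \<le> real m * d" "real m * d \<le> q" using d by (auto simp: algebra_simps)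
    have "integral {0..q} f \<le> (\<Sum>j<Suc m. d * f (real (Suc j) * d))"
      using integral_le_riemann_sum[of f "Suc m" d] int mono d by simp
    also have "\<dots> \<le> d * f 0 + (\<Sum>j<Suc m. d * f (real (Suc j) * d))"
      using d f0[of 0] q by simp
    also have "\<dots> = (\<Sum>j<Suc (Suc m). d * f (real j * d))"
      unfolding sum.lessThan_Suc_shift[of _ "Suc m"] by simp
    also have "\<dots> = (\<Sum>j<m. d * f (real j * d)) + d * f (real m * d) + d * f q"
      using d(2) by (simp only: sum.lessThan_Suc)
    also have "\<dots> \<le> (\<Sum>j<m. d * f (real j * d)) + d * f q + d * f q"
      using mono[OF m order_refl] d by (simp add: mult_left_mono)
    also have "(\<Sum>j<m. d * f (real j * d)) \<le> E_star M J \<gamma> q"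
      using E_star_ge_riemann_sum[OF assms(1,2) q assms(4) d_def] by (simp add: f_def mult.commute[of d])
    finally show ?thesis by (simp add: d_def)
  qed
  have "(\<lambda>m. integral {0..q} f - 2 * (q / real (Suc m)) * f q) \<longlonglongrightarrow> integral {0..q} f - 2 * 0 * f q"
    by (intro tendsto_intros) real_asymp
  then have "integral {0..q} f - 2 * 0 * f q \<le> E_star M J \<gamma> q"
    by (rule LIMSEQ_le_const2) (use bound in auto)
  moreover have "integral {0..q} (\<lambda>t. sqrt ((deriv ^^ 2) (mixture \<gamma>) t)) = integral {0..q} f"
    using deriv2_mixture[OF assms(1)] q by (intro integral_cong) (auto simp: f_def)
  ultimately show ?thesis by simp
qed

end
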